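(* Let $h_1,h_2$ be two regular solutions of the Hele-Shaw equation $\partial_t h+G(h)h=0$ defined on the same time interval $[0,T]$, such that, initially, $h_1(0,\cdot)\le h_2(0,\cdot)$ on $\mathbf{T}^n$. Then $$h_1(t,\cdot)\le h_2(t,\cdot)\quad\text{on }\mathbf{T}^n$$ for all $t\in[0,T]$.
   Context: $\mathbf{T}^n$ is an $n$-dimensional torus, $n\ge1$; $\nabla=\nabla_x$. Dirichlet to Neumann operator: given $h:\mathbf{T}^n\to\mathbf{R}$, set $\Omega=\{(x,y)\in\mathbf{T}^n\times\mathbf{R}: y<h(x)\}$. For $\psi:\mathbf{T}^n\to\mathbf{R}$, its harmonic extension $\varphi$ is the unique (variational) solution of $\Delta_{x,y}\varphi=0$ in $\Omega$, $\varphi(x,h(x))=\psi(x)$, with $\nabla_{x,y}\varphi\in L^2(\Omega)$. Then $G(h)\psi(x)=(\partial_y\varphi)(x,h(x))-\nabla h(x)\cdot(\nabla\varphi)(x,h(x))$. When $h,\psi$ depend on time $t$, $G(h)\psi$ is computed at each fixed $t$. Regular solution on $[0,T]$: a solution $h$ of $\partial_t h+G(h)h=0$ such that, for some $s>n/2+1$, $h\in C^0([0,T];H^s(\mathbf{T}^n))\cap C^1([0,T];H^{s-1}(\mathbf{T}^n))\cap L^2([0,T];H^{s+1/2}(\mathbf{T}^n))$ and $h\in C^\infty((0,T]\times\mathbf{T}^n)$. *)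

theory Defs
  imports "HOL-Analysis.Analysis"
begin

section \<open>The torus\<close>

text \<open>
  Functions on the torus \<open>(\<real> / 2\<pi>\<int>)\<^sup>n\<close> are functions on \<open>\<real>\<^sup>n\<close> that are \<open>2\<pi>\<close>-periodic in each
  coordinate; integrals over the torus are integrals over one period cell.
\<close>

definition torus_periodic :: "(real ^ 'n \<Rightarrow> 'a) \<Rightarrow> bool" where
  "torus_periodic f \<longleftrightarrow> (\<forall>x i. f (x + (2 * pi) *\<^sub>R axis i 1) = f x)"

definition torus_cell :: "(real ^ 'n) set" where
  "torus_cell = cbox 0 (\<chi> i. 2 * pi)"


section \<open>Functions of class \<open>C\<^sup>k\<close> and \<open>C\<^sup>\<infinity>\<close>; harmonic functions\<close>

text \<open>
  Derivatives are taken within \<open>S\<close>. This is used for open \<open>S\<close> and for \<open>S = (0,T] \<times> \<real>\<^sup>n\<close>, where it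
  amounts to one-sided time derivatives at \<open>T\<close>; in both cases derivatives within \<open>S\<close> are unique.
\<close>

primrec Ck_on :: "nat \<Rightarrow> ('a::euclidean_space \<Rightarrow> real) \<Rightarrow> 'a set \<Rightarrow> bool" where
  "Ck_on 0 f S \<longleftrightarrow> continuous_on S f"
| "Ck_on (Suc k) f S \<longleftrightarrow>
     (\<exists>f'. (\<forall>z\<in>S. (f has_derivative f' z) (at z within S)) \<and> (\<forall>v. Ck_on k (\<lambda>z. f' z v) S))"

definition C_infinity_on :: "('a::euclidean_space \<Rightarrow> real) \<Rightarrow> 'a set \<Rightarrow> bool" where
  "C_infinity_on f S \<longleftrightarrow> (\<forall>k. Ck_on k f S)"

definition laplacian :: "('a::euclidean_space \<Rightarrow> real) \<Rightarrow> 'a \<Rightarrow> real" where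
  "laplacian f z = (\<Sum>b\<in>Basis. deriv (deriv (\<lambda>r. f (z + r *\<^sub>R b))) 0)"

definition harmonic_on :: "('a::euclidean_space \<Rightarrow> real) \<Rightarrow> 'a set \<Rightarrow> bool" where
  "harmonic_on f S \<longleftrightarrow> Ck_on 2 f S \<and> (\<forall>z\<in>S. laplacian f z = 0)"


section \<open>The Dirichlet to Neumann operator\<close>

definition fluid_domain :: "(real ^ 'n \<Rightarrow> real) \<Rightarrow> ((real ^ 'n) \<times> real) set" where
  "fluid_domain h = {(x, y). y < h x}"

definition closed_fluid_domain :: "(real ^ 'n \<Rightarrow> real) \<Rightarrow> ((real ^ 'n) \<times> real) set" where
  "closed_fluid_domain h = {(x, y). y \<le> h x}"

text \<open>
  A variational solution is smooth in the open domain by Weyl's lemma, and for the data considered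
  here (\<open>h\<close> and \<open>\<psi>\<close> at least \<open>C\<^sup>1\<close>) it is continuous up to the boundary, where it takes the values
  \<open>\<psi>\<close>. Finite Dirichlet energy over one period then determines it uniquely on the closed domain;
  the values of \<open>\<phi>\<close> above the graph of \<open>h\<close> are irrelevant.
\<close>

definition harmonic_extension ::
    "(real ^ 'n \<Rightarrow> real) \<Rightarrow> (real ^ 'n \<Rightarrow> real) \<Rightarrow> ((real ^ 'n) \<times> real \<Rightarrow> real) \<Rightarrow> bool" where
  "harmonic_extension h \<psi> \<phi> \<longleftrightarrow>
     (\<forall>y. torus_periodic (\<lambda>x. \<phi> (x, y))) \<and>
     continuous_on (closed_fluid_domain h) \<phi> \<and>
     harmonic_on \<phi> (fluid_domain h) \<and>
     (\<forall>x. \<phi> (x, h x) = \<psi> x) \<and>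
     (\<exists>grad. (\<forall>z\<in>fluid_domain h. GDERIV \<phi> z :> grad z) \<and>
        set_integrable lebesgue (fluid_domain h \<inter> torus_cell \<times> UNIV) (\<lambda>z. (norm (grad z))\<^sup>2))"

text \<open>
  \<open>has_dirichlet_neumann h \<psi> g\<close> says that \<open>G(h)\<psi>\<close> is defined at every point and equals \<open>g\<close>. The
  gradient \<open>D\<phi> = (\<nabla>\<phi>, \<partial>\<^sub>y\<phi>)\<close> at the boundary point \<open>(x, h x)\<close> is the derivative of \<open>\<phi>\<close> within the
  closed domain.
\<close>

definition has_dirichlet_neumann ::
    "(real ^ 'n \<Rightarrow> real) \<Rightarrow> (real ^ 'n \<Rightarrow> real) \<Rightarrow> (real ^ 'n \<Rightarrow> real) \<Rightarrow> bool" where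
  "has_dirichlet_neumann h \<psi> g \<longleftrightarrow>
     (\<exists>\<phi>. harmonic_extension h \<psi> \<phi> \<and>
        (\<forall>x. \<exists>Dh D\<phi>. GDERIV h x :> Dh \<and>
           (\<phi> has_derivative (\<lambda>v. v \<bullet> D\<phi>)) (at (x, h x) within closed_fluid_domain h) \<and>
           g x = snd D\<phi> - Dh \<bullet> fst D\<phi>))"


section \<open>Sobolev spaces on the torus\<close>

definition freq :: "int ^ 'n \<Rightarrow> real ^ 'n" where
  "freq k = (\<chi> i. of_int (k $ i))"

definition fourier_coeff :: "(real ^ 'n \<Rightarrow> real) \<Rightarrow> int ^ 'n \<Rightarrow> complex" where
  "fourier_coeff f k =
     (LINT x:torus_cell|lebesgue. complex_of_real (f x) * cis (- (freq k \<bullet> x))) / (2 * pi) ^ CARD('n)"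

definition sobolev_term :: "real \<Rightarrow> (real ^ 'n \<Rightarrow> real) \<Rightarrow> int ^ 'n \<Rightarrow> real" where
  "sobolev_term s f k = (1 + (norm (freq k))\<^sup>2) powr s * (cmod (fourier_coeff f k))\<^sup>2"

text \<open>
  Only exponents \<open>s \<ge> 0\<close> occur, so \<open>H\<^sup>s\<close> is a subspace of \<open>L\<^sup>2\<close>.
\<close>

definition in_sobolev :: "real \<Rightarrow> (real ^ 'n \<Rightarrow> real) \<Rightarrow> bool" where
  "in_sobolev s f \<longleftrightarrow>
     torus_periodic f \<and>
     f \<in> borel_measurable lebesgue \<and>
     set_integrable lebesgue torus_cell (\<lambda>x. (f x)\<^sup>2) \<and>
     sobolev_term s f summable_on UNIV"

definition sobolev_norm :: "real \<Rightarrow> (real ^ 'n \<Rightarrow> real) \<Rightarrow> real" where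
  "sobolev_norm s f = sqrt (\<Sum>\<^sub>\<infinity>k. sobolev_term s f k)"

definition C0_sobolev :: "real \<Rightarrow> real set \<Rightarrow> (real \<Rightarrow> real ^ 'n \<Rightarrow> real) \<Rightarrow> bool" where
  "C0_sobolev s I u \<longleftrightarrow>
     (\<forall>t\<in>I. in_sobolev s (u t) \<and>
        ((\<lambda>\<tau>. sobolev_norm s (\<lambda>x. u \<tau> x - u t x)) \<longlongrightarrow> 0) (at t within I))"

definition C1_sobolev :: "real \<Rightarrow> real set \<Rightarrow> (real \<Rightarrow> real ^ 'n \<Rightarrow> real) \<Rightarrow> bool" where
  "C1_sobolev s I u \<longleftrightarrow>
     C0_sobolev s I u \<and>
     (\<exists>u'. C0_sobolev s I u' \<and>
        (\<forall>t\<in>I. ((\<lambda>\<tau>. sobolev_norm s (\<lambda>x. (u \<tau> x - u t x) / (\<tau> - t) - u' t x)) \<longlongrightarrow> 0)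
                  (at t within I)))"

text \<open>
  Since \<open>H\<^sup>s\<close> is a separable Hilbert space, strong measurability of \<open>u\<close> is equivalent to measurability
  of all its Fourier coefficients (Pettis).
\<close>

definition L2_sobolev :: "real \<Rightarrow> real set \<Rightarrow> (real \<Rightarrow> real ^ 'n \<Rightarrow> real) \<Rightarrow> bool" where
  "L2_sobolev s I u \<longleftrightarrow>
     (\<forall>k. (\<lambda>t. fourier_coeff (u t) k) \<in> borel_measurable (lebesgue_on I)) \<and>
     (AE t in lebesgue_on I. in_sobolev s (u t)) \<and>
     set_integrable lebesgue I (\<lambda>t. (sobolev_norm s (u t))\<^sup>2)"


section \<open>Regular solutions of the Hele-Shaw equation\<close>

definition hele_shaw_solution :: "real \<Rightarrow> (real \<Rightarrow> real ^ 'n \<Rightarrow> real) \<Rightarrow> bool" where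
  "hele_shaw_solution T h \<longleftrightarrow>
     (\<forall>t\<in>{0..T}. \<exists>h\<^sub>t g.
        (\<forall>x. ((\<lambda>\<tau>. h \<tau> x) has_real_derivative h\<^sub>t x) (at t within {0..T})) \<and>
        has_dirichlet_neumann (h t) (h t) g \<and>
        (\<forall>x. h\<^sub>t x + g x = 0))"

text \<open>
  Because \<open>s - 1 > n/2\<close>, the Sobolev regularity makes \<open>h(t,\<cdot>)\<close> and \<open>\<partial>\<^sub>t h(t,\<cdot>)\<close> continuous on the torus up
  to modification on null sets. The continuity requirement selects the continuous representative
  of \<open>h(0,\<cdot>)\<close>, so that pointwise statements at \<open>t = 0\<close> are meaningful.
\<close>

definition regular_solution :: "real \<Rightarrow> (real \<Rightarrow> real ^ 'n \<Rightarrow> real) \<Rightarrow> bool" where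
  "regular_solution T h \<longleftrightarrow>
     hele_shaw_solution T h \<and>
     (\<exists>s > CARD('n) / 2 + 1.
        C0_sobolev s {0..T} h \<and>
        C1_sobolev (s - 1) {0..T} h \<and>
        L2_sobolev (s + 1 / 2) {0..T} h) \<and>
     continuous_on UNIV (h 0) \<and>
     C_infinity_on (\<lambda>(t, x). h t x) ({0<..T} \<times> UNIV)"

end

theory Submission
  imports Defs
begin

text \<open>
  The comparison follows from a first contact argument. Replace \<open>h\<^sub>2\<close> by \<open>h\<^sub>2 + \<epsilon> (1 + t)\<close>, which lies
  strictly above \<open>h\<^sub>1\<close> initially, and suppose that \<open>h\<^sub>1\<close> touches it for the first time at \<open>(t\<^sub>0, x\<^sub>0)\<close>. Then
  \<open>\<partial>\<^sub>t h\<^sub>1 \<ge> \<partial>\<^sub>t h\<^sub>2 + \<epsilon>\<close> there. On the other hand, at time \<open>t\<^sub>0\<close> the fluid domain of \<open>h\<^sub>1\<close> lies inside the domain of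
  the raised \<open>h\<^sub>2\<close> and touches its boundary from inside. Raising a graph and its boundary data by a
  constant \<open>c\<close> translates the domain and the extension, and leaves \<open>G(h)h\<close> unchanged. If the extensions
  satisfy \<open>\<phi>\<^sub>1 \<le> \<phi>\<^sub>2\<close> on the smaller domain, with equality at the contact point, then the outward normal derivative of
  \<open>\<phi>\<^sub>1\<close> there is the larger one: \<open>G(h\<^sub>1)h\<^sub>1 \<ge> G(h\<^sub>2)h\<^sub>2\<close> (\<open>dirichlet_neumann_contact\<close>), that is,
  \<open>\<partial>\<^sub>t h\<^sub>1 \<le> \<partial>\<^sub>t h\<^sub>2\<close>, a contradiction. Now let \<open>\<epsilon> \<rightarrow> 0\<close>.

  The ordering of the extensions (\<open>harmonic_extension_comparison\<close>) uses a maximum principle twice: for \<open>y - \<phi>\<^sub>2\<close>, which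
  vanishes on the graph of \<open>h\<^sub>2\<close>, to get \<open>\<phi>\<^sub>2 \<ge> y\<close>; and then for \<open>\<phi>\<^sub>1 - \<phi>\<^sub>2\<close> on the smaller domain,
  where the first step supplies the sign on the boundary. The domain is unbounded below, and what is known
  there is finite energy instead of a pointwise bound. The maximum principle (\<open>fluid_maximum_principle\<close>)
  therefore works with means: for a suitable convex \<open>F\<close> that vanishes on \<open>(-\<infinity>, 0]\<close>, the integral of
  \<open>F (w - \<delta>)\<close> over one period at height \<open>y\<close> is a convex function of \<open>y\<close>, zero above the graph, and finite energy as
  \<open>y \<rightarrow> -\<infinity>\<close> excludes that its slope is ever negative; so it vanishes.

  For a first contact time to exist, the solutions must stay uniformly close to their initial
  values for small times. This is the Sobolev embedding \<open>\<bar>f\<bar> \<le> C \<parallel>f\<parallel>\<^sub>s\<close> for \<open>s > n/2\<close> (\<open>sobolev_embedding\<close>),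
  obtained by testing \<open>f\<close> against nonnegative trigonometric polynomials that concentrate at a point.
\<close>

section \<open>Integrals of periodic functions over the cell\<close>

abbreviation two_pi :: "real ^ 'n" where "two_pi \<equiv> (\<chi> i. 2 * pi)"

lemma torus_periodicD: "torus_periodic f \<Longrightarrow> f (x + (2 * pi) *\<^sub>R axis i 1) = f x"
  by (simp add: torus_periodic_def)

text \<open>
  Cut the shifted cell at the face \<open>x\<^sub>i = 2\<pi>\<close>. The slab beyond that face, \<open>x\<^sub>i \<in> [2\<pi>, 2\<pi> + s]\<close>, contributes by
  periodicity exactly what the missing slab \<open>x\<^sub>i \<in> [0, s]\<close> contributes.
\<close>

lemma torus_integral_translate_axis:
  fixes f :: "real ^ 'n \<Rightarrow> 'b::euclidean_space"
  assumes per: "torus_periodic f" and cont: "continuous_on UNIV f" and s: "0 \<le> s" "s \<le> 2 * pi"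
  shows "integral torus_cell (\<lambda>x. f (x + s *\<^sub>R axis i 1)) = integral torus_cell f"
proof -
  define slab :: "real \<Rightarrow> real \<Rightarrow> (real ^ 'n) set" where
    "slab u v = cbox (u *\<^sub>R axis i 1) (two_pi + (v - 2 * pi) *\<^sub>R axis i 1)" for u v
  define J where "J u v = integral (slab u v) f" for u v
  have int: "f integrable_on cbox a b" for a b
    using cont by (intro integrable_continuous) (auto intro: continuous_on_subset)
  have ax: "(axis i 1 :: real ^ 'n) \<in> Basis"
    by (simp add: axis_in_Basis_iff)
  have mem: "x \<in> slab u v \<longleftrightarrow> u \<le> x $ i \<and> x $ i \<le> v \<and> (\<forall>j. j \<noteq> i \<longrightarrow> 0 \<le> x $ j \<and> x $ j \<le> 2 * pi)"
    for x u v
  proof -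
    have "x \<in> slab u v \<longleftrightarrow> (\<forall>j. (if j = i then u else 0) \<le> x $ j \<and> x $ j \<le> (if j = i then v else 2 * pi))"
      unfolding slab_def mem_box_cart by (rule iff_allI) (simp add: axis_def)
    then show ?thesis
      by (auto split: if_split_asm)
  qed
  have split: "J u w = J u v + J v w" if "u \<le> v" "v \<le> w" for u v w
  proof -
    have "slab u w \<inter> {x. x \<bullet> axis i 1 \<le> v} = slab u v"
      using that by (auto simp: mem inner_axis)
    moreover have "slab u w \<inter> {x. x \<bullet> axis i 1 \<ge> v} = slab v w"
      using that by (auto simp: mem inner_axis)
    ultimately show ?thesis
      using integral_split[OF int[of "u *\<^sub>R axis i 1" "two_pi + (w - 2 * pi) *\<^sub>R axis i 1"] ax, of v]
      by (simp add: J_def slab_def)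
  qed
  have shift: "integral (slab u v) (\<lambda>x. f (x + r *\<^sub>R axis i 1)) = J (u + r) (v + r)" for u v r
  proof -
    have eq: "slab (u + r) (v + r) = cbox (u *\<^sub>R axis i 1 + r *\<^sub>R axis i 1)
       (two_pi + (v - 2 * pi) *\<^sub>R axis i 1 + r *\<^sub>R axis i 1)"
      unfolding slab_def by (simp add: algebra_simps)
    have "f \<circ> (+) (r *\<^sub>R axis i 1) = (\<lambda>x. f (x + r *\<^sub>R axis i 1))"
      by (auto simp: o_def add.commute)
    then show ?thesis
      unfolding J_def eq using integral_shift_cbox_plus[of "u *\<^sub>R axis i 1" _ f "r *\<^sub>R axis i 1"]
      by (simp add: slab_def)
  qed
  have cell: "torus_cell = slab 0 (2 * pi)"
    by (simp add: torus_cell_def slab_def)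
  have "J (0 + 2 * pi) (s + 2 * pi) = J 0 s"
    using shift[of 0 s "2 * pi"] per by (simp add: torus_periodicD J_def)
  then have "J (0 + s) (2 * pi + s) = J 0 (2 * pi)"
    using split[of s "2 * pi" "2 * pi + s"] split[of 0 s "2 * pi"] s by (simp add: add.commute)
  then show ?thesis
    using shift[of 0 "2 * pi" s] by (simp add: cell J_def)
qed

text \<open>
  The integral of \<open>x \<mapsto> f (x + s e\<^sub>i)\<close> does not depend on \<open>s \<in> [0, 2\<pi>]\<close>; differentiate at \<open>s = 0\<close> under the
  integral sign.
\<close>

lemma torus_integral_partial_derivative:
  fixes f g :: "real ^ 'n \<Rightarrow> real"
  assumes per: "torus_periodic f" and cont: "continuous_on UNIV f" "continuous_on UNIV g"
    and der: "\<And>x. ((\<lambda>s. f (x + s *\<^sub>R axis i 1)) has_real_derivative g x) (at 0)"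
  shows "integral torus_cell g = 0"
proof -
  have der': "((\<lambda>s. f (x + s *\<^sub>R axis i 1)) has_real_derivative g (x + s *\<^sub>R axis i 1)) (at s within S)"
    for x s S
  proof -
    have "((\<lambda>r. f ((x + s *\<^sub>R axis i 1) + (r - s) *\<^sub>R axis i 1)) has_real_derivative
        g (x + s *\<^sub>R axis i 1)) (at s)"
      using DERIV_shift[of "\<lambda>r. f ((x + s *\<^sub>R axis i 1) + r *\<^sub>R axis i 1)" _ s "- s"]
        der[of "x + s *\<^sub>R axis i 1"] by (simp add: )
    moreover have "(x + s *\<^sub>R axis i 1) + (r - s) *\<^sub>R axis i 1 = x + r *\<^sub>R axis i 1" for r
      by (simp add: scaleR_left_diff_distrib)
    ultimately show ?thesis
      by (simp add: has_field_derivative_at_within)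
  qed
  have cf: "continuous_on A (\<lambda>x. f (x + s *\<^sub>R axis i 1))" for A s
    by (rule continuous_on_compose2[OF cont(1)]) (auto intro!: continuous_intros)
  have "((\<lambda>s. integral torus_cell (\<lambda>x. f (x + s *\<^sub>R axis i 1))) has_real_derivative
      integral torus_cell (\<lambda>x. g (x + 0 *\<^sub>R axis i 1))) (at 0 within {0..2 * pi})"
    unfolding torus_cell_def
  proof (rule leibniz_rule_field_derivative)
    show "continuous_on ({0..2 * pi} \<times> cbox 0 two_pi) (\<lambda>(s, x). g (x + s *\<^sub>R axis i 1))"
      unfolding split_beta
      by (rule continuous_on_compose2[OF cont(2)]) (auto intro!: continuous_intros)
  qed (auto intro!: der' integrable_continuous cf)
  moreover have "((\<lambda>s. integral torus_cell (\<lambda>x. f (x + s *\<^sub>R axis i 1))) has_real_derivative 0)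
      (at 0 within {0..2 * pi})"
    by (rule has_field_derivative_transform_within[of "\<lambda>_. integral torus_cell f" _ _ _ 1])
      (auto simp: torus_integral_translate_axis[OF per cont(1)])
  moreover have "at (0::real) within {0..2 * pi} \<noteq> bot"
    by (simp add: at_within_Icc_at_right)
  ultimately show ?thesis
    using has_field_derivative_unique by fastforce
qed

lemma sum_over_Basis_prod:
  fixes f :: "'a::euclidean_space \<times> 'b::euclidean_space \<Rightarrow> 'c::comm_monoid_add"
  shows "sum f Basis = (\<Sum>b\<in>Basis. f (b, 0)) + (\<Sum>b\<in>Basis. f (0, b))"
proof -
  have "inj_on (\<lambda>u. (u::'a, 0::'b)) Basis" "inj_on (\<lambda>u. (0::'a, u::'b)) Basis"
    by (auto intro!: inj_onI)
  then show ?thesis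
    unfolding Basis_prod_def by (subst sum.union_disjoint) (auto simp: sum.reindex)
qed

lemma has_derivative_along_line:
  fixes F :: "'a::real_normed_vector \<Rightarrow> real"
  assumes "(F has_derivative F') (at (z + r *\<^sub>R v))"
  shows "((\<lambda>s. F (z + s *\<^sub>R v)) has_real_derivative F' v) (at r)"
proof -
  have "((\<lambda>s. F (z + s *\<^sub>R v)) has_derivative (\<lambda>s. F' (s *\<^sub>R v))) (at r)"
    by (rule has_derivative_compose[of "\<lambda>s. z + s *\<^sub>R v" _ _ _ F F'])
      (use assms in \<open>auto intro!: derivative_eq_intros\<close>)
  moreover have "F' (s *\<^sub>R v) = F' v * s" for s
    using linear_scale[OF has_derivative_linear[OF assms]] by simp
  ultimately show ?thesis
    by (simp add: has_field_derivative_def)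
qed

text \<open>
  The second \<open>y\<close>-derivative of the horizontal mean is the mean of \<open>\<partial>\<^sub>y\<^sub>y P\<close>. The horizontal second
  derivatives have mean zero, so they may be added: what appears is the mean of the full Laplacian.
  Hence the horizontal mean of a subharmonic function is convex in \<open>y\<close>.
\<close>

lemma torus_mean_second_derivative:
  fixes P :: "(real ^ 'n) \<times> real \<Rightarrow> real"
  assumes der: "\<And>z. (P has_derivative P' z) (at z)"
    and der2: "\<And>z v. ((\<lambda>z. P' z v) has_derivative P'' v z) (at z)"
    and cont2: "\<And>v u. continuous_on UNIV (\<lambda>z. P'' v z u)"
    and per: "\<And>y. torus_periodic (\<lambda>x. P (x, y))"
  shows "((\<lambda>y. integral torus_cell (\<lambda>x. P (x, y))) has_real_derivative
            integral torus_cell (\<lambda>x. P' (x, y) (0, 1))) (at y)"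
    and "((\<lambda>y. integral torus_cell (\<lambda>x. P' (x, y) (0, 1))) has_real_derivative
            integral torus_cell (\<lambda>x. \<Sum>b\<in>Basis. P'' b (x, y) b)) (at y)"
proof -
  have c0: "continuous_on A P" for A
    using der by (meson continuous_at_imp_continuous_on has_derivative_continuous)
  have c1: "continuous_on A (\<lambda>z. P' z v)" for A v
    using der2 by (meson continuous_at_imp_continuous_on has_derivative_continuous)
  have c2: "continuous_on A (\<lambda>z. P'' v z u)" for A v u
    using cont2 by (rule continuous_on_subset) auto
  note cs = continuous_on_compose2[OF c0[of UNIV]] continuous_on_compose2[OF c1[of UNIV]]
    continuous_on_compose2[OF c2[of UNIV]]
  have liney: "((\<lambda>y. F (x, y)) has_real_derivative F' (0, 1)) (at y)"
    if "(F has_derivative F') (at (x, y))" for F :: "(real ^ 'n) \<times> real \<Rightarrow> real" and F' x y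
    using has_derivative_along_line[of F F' "(x, 0)" y "(0, 1)"] that by simp
  have linex: "((\<lambda>s. F (x + s *\<^sub>R axis i 1, y)) has_real_derivative F' (axis i 1, 0)) (at 0)"
    if "(F has_derivative F') (at (x, y))" for F :: "(real ^ 'n) \<times> real \<Rightarrow> real" and F' x y i
    using has_derivative_along_line[of F F' "(x, y)" 0 "(axis i 1, 0)"] that by simp
  show "((\<lambda>y. integral torus_cell (\<lambda>x. P (x, y))) has_real_derivative
            integral torus_cell (\<lambda>x. P' (x, y) (0, 1))) (at y)"
    unfolding torus_cell_def
    by (rule leibniz_rule_field_derivative)
      (auto simp: split_beta intro!: liney der integrable_continuous cs continuous_intros)
  have *: "((\<lambda>y. integral torus_cell (\<lambda>x. P' (x, y) (0, 1))) has_real_derivative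
            integral torus_cell (\<lambda>x. P'' (0, 1) (x, y) (0, 1))) (at y)"
    unfolding torus_cell_def
    by (rule leibniz_rule_field_derivative)
      (auto simp: split_beta intro!: liney[OF der2] integrable_continuous cs continuous_intros)
  have per': "torus_periodic (\<lambda>x. P' (x, y) v)" for y v
    unfolding torus_periodic_def
  proof safe
    fix x :: "real ^ 'n" and i
    have "P (z + ((2 * pi) *\<^sub>R axis i 1, 0)) = P z" for z
      using torus_periodicD[OF per[of "snd z"], of "fst z" i] by (simp add: prod_eq_iff plus_prod_def)
    moreover have "((\<lambda>z. z + ((2 * pi) *\<^sub>R axis i (1::real), 0::real)) has_derivative (\<lambda>z. z)) (at (x, y))"
      by (auto intro!: derivative_eq_intros)
    note has_derivative_compose[OF this der]
    ultimately have "(P has_derivative P' ((x, y) + ((2 * pi) *\<^sub>R axis i 1, 0))) (at (x, y))"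
      by simp
    then have "P' ((x, y) + ((2 * pi) *\<^sub>R axis i 1, 0)) = P' (x, y)"
      using der has_derivative_unique by blast
    then show "P' (x + (2 * pi) *\<^sub>R axis i 1, y) v = P' (x, y) v"
      by simp
  qed
  have zero: "integral torus_cell (\<lambda>x. P'' (axis i 1, 0) (x, y) (axis i 1, 0)) = 0" for i :: 'n
    by (rule torus_integral_partial_derivative[where i = i and f = "\<lambda>x. P' (x, y) (axis i 1, 0)"])
      (auto intro!: per' linex[OF der2] cs continuous_intros)
  have int: "(\<lambda>x. P'' v (x, y) u) integrable_on torus_cell" for v u
    unfolding torus_cell_def by (auto intro!: integrable_continuous cs continuous_intros)
  have "integral torus_cell (\<lambda>x. \<Sum>b\<in>Basis. P'' b (x, y) b)
      = (\<Sum>b\<in>Basis. integral torus_cell (\<lambda>x. P'' (b, 0) (x, y) (b, 0)))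
        + integral torus_cell (\<lambda>x. P'' (0, 1) (x, y) (0, 1))"
    by (subst integral_sum) (simp_all add: int sum_over_Basis_prod)
  also have "(\<Sum>b\<in>Basis. integral torus_cell (\<lambda>x. P'' (b, 0) (x, y) (b, 0))) = 0"
    using zero by (intro sum.neutral) (auto simp: Basis_vec_def)
  finally show "((\<lambda>y. integral torus_cell (\<lambda>x. P' (x, y) (0, 1))) has_real_derivative
            integral torus_cell (\<lambda>x. \<Sum>b\<in>Basis. P'' b (x, y) b)) (at y)"
    using * by simp
qed

section \<open>Periodic functions are determined on the cell\<close>

lemma torus_periodic_lattice:
  assumes per: "torus_periodic f"
  shows "f (x + (2 * pi) *\<^sub>R freq k) = f x"
proof -
  have one: "f (x + (2 * pi * of_int m) *\<^sub>R axis i 1) = f x" for x m i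
  proof (induction m arbitrary: x rule: int_induct[where k = 0])
    case (step1 m)
    have "f (x + (2 * pi * of_int (m + 1)) *\<^sub>R axis i 1)
        = f ((x + (2 * pi) *\<^sub>R axis i 1) + (2 * pi * of_int m) *\<^sub>R axis i 1)"
      by (simp add: distrib_left scaleR_left_distrib add_ac)
    then show ?case
      by (simp add: step1 torus_periodicD[OF per])
  next
    case (step2 m)
    have "f (x + (2 * pi * of_int (m - 1)) *\<^sub>R axis i 1)
        = f ((x + (2 * pi * of_int (m - 1)) *\<^sub>R axis i 1) + (2 * pi) *\<^sub>R axis i 1)"
      by (simp add: torus_periodicD[OF per])
    also have "\<dots> = f (x + (2 * pi * of_int m) *\<^sub>R axis i 1)"
      by (simp add: right_diff_distrib scaleR_left_diff_distrib)
    finally show ?case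
      by (simp add: step2)
  qed simp
  have "f (x + (\<Sum>i\<in>A. (2 * pi * of_int (k $ i)) *\<^sub>R axis i 1)) = f x" if "finite A" for A
    using that
  proof (induction A arbitrary: x)
    case (insert a A)
    then show ?case
      by (simp add: one add.assoc[symmetric])
  qed simp
  moreover have "(\<Sum>i\<in>UNIV. (2 * pi * of_int (k $ i)) *\<^sub>R axis i 1) = (2 * pi) *\<^sub>R freq k"
    by (simp add: vec_eq_iff freq_def axis_def if_distrib cong: if_cong)
  ultimately show ?thesis
    by (metis finite)
qed

lemma torus_cell_representative:
  fixes x :: "real ^ 'n"
  obtains k where "x + (2 * pi) *\<^sub>R freq k \<in> torus_cell"
proof
  define k :: "int ^ 'n" where "k = (\<chi> i. - \<lfloor>x $ i / (2 * pi)\<rfloor>)"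
  have "0 \<le> x $ i + 2 * pi * of_int (k $ i)" "x $ i + 2 * pi * of_int (k $ i) \<le> 2 * pi" for i
  proof -
    have "of_int \<lfloor>x $ i / (2 * pi)\<rfloor> * (2 * pi) \<le> x $ i" "x $ i < (of_int \<lfloor>x $ i / (2 * pi)\<rfloor> + 1) * (2 * pi)"
      using floor_divide_lower[of "2 * pi" "x $ i"] floor_divide_upper[of "2 * pi" "x $ i"] by simp_all
    then show "0 \<le> x $ i + 2 * pi * of_int (k $ i)" "x $ i + 2 * pi * of_int (k $ i) \<le> 2 * pi"
      by (simp_all add: k_def algebra_simps)
  qed
  then show "x + (2 * pi) *\<^sub>R freq k \<in> torus_cell"
    by (simp add: torus_cell_def mem_box_cart freq_def)
qed

lemma torus_periodic_bounded_above:
  fixes f :: "real ^ 'n \<Rightarrow> real"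
  assumes "torus_periodic f" "continuous_on UNIV f"
  obtains B where "\<And>x. f x \<le> B"
proof -
  have "compact (f ` torus_cell)"
    unfolding torus_cell_def
    using assms(2) by (intro compact_continuous_image) (auto intro: continuous_on_subset)
  then obtain B where B: "\<And>x. x \<in> torus_cell \<Longrightarrow> f x \<le> B"
    using compact_imp_bounded[THEN bounded_imp_bdd_above] by (force simp: bdd_above_def)
  have "f x \<le> B" for x
    using torus_cell_representative[of x] torus_periodic_lattice[OF assms(1), of x] B by metis
  then show thesis
    using that by blast
qed

section \<open>A maximum principle for functions of finite energy\<close>

text \<open>
  A smooth substitute for the positive part: it vanishes on \<open>(-\<infinity>, 0]\<close>, is positive on \<open>(0, \<infinity>)\<close>, convex,
  of class \<open>C\<^sup>2\<close>, and has slope at most 1. Convexity makes its composition with a harmonic function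
  subharmonic, two derivatives at 0 allow that composition to be continued by zero, and the
  bounded slope keeps the energy under control.
\<close>

definition soft_ramp :: "real \<Rightarrow> real" where
  "soft_ramp s = max 0 s - arctan (max 0 s)"

definition soft_ramp' :: "real \<Rightarrow> real" where
  "soft_ramp' s = (max 0 s)\<^sup>2 / (1 + (max 0 s)\<^sup>2)"

definition soft_ramp'' :: "real \<Rightarrow> real" where
  "soft_ramp'' s = 2 * max 0 s / (1 + (max 0 s)\<^sup>2)\<^sup>2"

text \<open>
  At 0 the constant branch and \<open>g\<close> both have one-sided derivative 0.
\<close>

lemma has_real_derivative_max_0:
  fixes g :: "real \<Rightarrow> real"
  assumes g: "\<And>s. (g has_real_derivative g' s) (at s)" and zero: "g' 0 = 0"
  shows "((\<lambda>s. g (max 0 s)) has_real_derivative (if s < 0 then 0 else g' s)) (at s)"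
proof -
  consider "s < 0" | "s > 0" | "s = 0" by linarith
  then show ?thesis
  proof cases
    case 1
    have "((\<lambda>s. g 0) has_real_derivative 0) (at s)" by simp
    then show ?thesis
      using 1 by (simp, elim has_field_derivative_transform_within_open[of _ _ _ "{..<0}"]) auto
  next
    case 2
    show ?thesis
      using 2 g[of s] by (simp, elim has_field_derivative_transform_within_open[of _ _ _ "{0<..}"]) auto
  next
    case 3
    have "((\<lambda>s. g (max 0 s)) has_real_derivative 0) (at 0 within {..0})"
      by (rule has_field_derivative_transform_within[of "\<lambda>s. g 0" _ _ _ 1]) (auto simp: max_def)
    moreover have "((\<lambda>s. g (max 0 s)) has_real_derivative 0) (at 0 within {0..})"
      by (rule has_field_derivative_transform_within[of g _ _ _ 1])
        (use g[of 0] zero in \<open>auto simp: max_def intro: has_field_derivative_at_within\<close>)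
    ultimately have "((\<lambda>s. g (max 0 s)) has_real_derivative 0) (at 0 within ({..0} \<union> {0..}))"
      unfolding has_field_derivative_iff by (simp add: Lim_within_Un)
    moreover have "{..0} \<union> {0..} = (UNIV :: real set)" by auto
    ultimately show ?thesis
      using 3 zero by simp
  qed
qed

lemma soft_ramp_deriv: "(soft_ramp has_real_derivative soft_ramp' s) (at s)"
proof -
  have "((\<lambda>s. s - arctan s) has_real_derivative s\<^sup>2 / (1 + s\<^sup>2)) (at s)" for s
    by (auto intro!: derivative_eq_intros simp: field_simps add_nonneg_eq_0_iff)
  from has_real_derivative_max_0[OF this, of s] show ?thesis
    by (simp add: soft_ramp_def[abs_def] soft_ramp'_def max_def split: if_splits)
qed

lemma soft_ramp'_deriv: "(soft_ramp' has_real_derivative soft_ramp'' s) (at s)"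
proof -
  have "((\<lambda>s. s\<^sup>2 / (1 + s\<^sup>2)) has_real_derivative 2 * s / (1 + s\<^sup>2)\<^sup>2) (at s)" for s :: real
  proof -
    have "1 + s\<^sup>2 \<noteq> 0" by (metis add_nonneg_eq_0_iff zero_le_one zero_le_power2 zero_neq_one)
    then show ?thesis
      by (auto intro!: derivative_eq_intros simp: field_simps power2_eq_square)
  qed
  from has_real_derivative_max_0[OF this, of s] show ?thesis
    by (simp add: soft_ramp'_def[abs_def] soft_ramp''_def max_def split: if_splits)
qed

lemma soft_ramp_simps:
  "s \<le> 0 \<Longrightarrow> soft_ramp s = 0" "s \<le> 0 \<Longrightarrow> soft_ramp' s = 0" "s \<le> 0 \<Longrightarrow> soft_ramp'' s = 0"
  "0 \<le> soft_ramp' s" "soft_ramp' s \<le> 1" "0 \<le> soft_ramp'' s" "continuous_on A soft_ramp''"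
  "s > 0 \<Longrightarrow> 0 < soft_ramp s" "0 \<le> soft_ramp s"
proof -
  show pos: "s > 0 \<Longrightarrow> 0 < soft_ramp s"
  proof -
    assume "s > 0"
    have "(\<lambda>s. s - arctan s) 0 < (\<lambda>s. s - arctan s) s"
    proof (rule DERIV_pos_imp_increasing_open[OF \<open>s > 0\<close>])
      fix x :: real assume "0 < x"
      then show "\<exists>y. ((\<lambda>s. s - arctan s) has_real_derivative y) (at x) \<and> 0 < y"
        by (intro exI[of _ "x\<^sup>2 / (1 + x\<^sup>2)"])
          (auto intro!: derivative_eq_intros divide_pos_pos add_pos_pos simp: field_simps add_nonneg_eq_0_iff)
    qed (auto intro!: continuous_intros)
    then show ?thesis
      using \<open>s > 0\<close> by (simp add: soft_ramp_def)
  qed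
  show le: "s \<le> 0 \<Longrightarrow> soft_ramp s = 0"
    by (simp add: soft_ramp_def)
  show "0 \<le> soft_ramp s"
    using pos le by (cases "s > 0") auto
  have pos: "0 < 1 + (max 0 x)\<^sup>2" for x :: real
    by (simp add: add_pos_nonneg)
  then have "1 + (max 0 x)\<^sup>2 \<noteq> 0" for x :: real
    by (metis less_irrefl)
  then show "continuous_on A soft_ramp''"
    unfolding soft_ramp''_def by (intro continuous_intros) auto
  show "soft_ramp' s \<le> 1"
    using pos[of s] by (simp add: soft_ramp'_def)
qed (auto simp: soft_ramp'_def soft_ramp''_def)

text \<open>
  \<open>E\<close> plays the role of an energy density. Only its integrals over boxes deep in the fluid matter:
  they see the behaviour as \<open>y \<rightarrow> -\<infinity>\<close>, they involve continuous integrands only, and vertical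
  translations are easily followed.
\<close>

definition finite_energy_below :: "((real ^ 'n) \<times> real \<Rightarrow> real) \<Rightarrow> bool" where
  "finite_energy_below E \<longleftrightarrow>
     (\<exists>y0 C. continuous_on (UNIV \<times> {..y0}) E \<and> (\<forall>x. \<forall>y\<le>y0. 0 \<le> E (x, y)) \<and>
        (\<forall>R. integral (cbox (0, R) (two_pi, y0)) E \<le> C))"

lemma open_fluid_domain: "continuous_on UNIV h \<Longrightarrow> open (fluid_domain h)"
proof -
  assume h: "continuous_on UNIV h"
  have "fluid_domain h = {z. snd z < h (fst z)}"
    by (auto simp: fluid_domain_def)
  also have "open \<dots>"
    by (intro open_Collect_less continuous_intros continuous_on_compose2[OF h]) auto
  finally show ?thesis .
qed

lemma closed_closed_fluid_domain: "continuous_on UNIV h \<Longrightarrow> closed (closed_fluid_domain h)"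
proof -
  assume h: "continuous_on UNIV h"
  have "closed_fluid_domain h = {z. snd z \<le> h (fst z)}"
    by (auto simp: closed_fluid_domain_def)
  also have "closed \<dots>"
    by (intro closed_Collect_le continuous_intros continuous_on_compose2[OF h]) auto
  finally show ?thesis .
qed

text \<open>
  Let \<open>Q y\<close> be the integral of \<open>P\<close> over the slice at height \<open>y\<close>. It is convex, and it vanishes near the
  top, so its slope is nondecreasing and nonpositive. If the slope were \<open>-a < 0\<close> somewhere, it would be at
  most \<open>-a\<close> at every lower height, and each of these infinitely many slices would carry at least
  a fixed amount of the energy of \<open>\<partial>\<^sub>y P\<close>. So \<open>Q\<close> is constant, equal to its value 0 at the top, and a continuous
  nonnegative \<open>P\<close> with zero integrals vanishes. The comparison
  with \<open>E\<close> is used only deep down, where \<open>E \<ge> 0\<close>; hence the harmless \<open>max 0 (E z)\<close>.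
\<close>

lemma subharmonic_vanishes_of_finite_energy:
  fixes P :: "(real ^ 'n) \<times> real \<Rightarrow> real"
  assumes der: "\<And>z. (P has_derivative P' z) (at z)"
    and der2: "\<And>z v. ((\<lambda>z. P' z v) has_derivative P'' v z) (at z)"
    and cont2: "\<And>v u. continuous_on UNIV (\<lambda>z. P'' v z u)"
    and per: "\<And>y. torus_periodic (\<lambda>x. P (x, y))"
    and sub: "\<And>z. 0 \<le> (\<Sum>b\<in>Basis. P'' b z b)"
    and nonneg: "\<And>z. 0 \<le> P z"
    and top: "\<And>x y. H \<le> y \<Longrightarrow> P (x, y) = 0" "\<And>x y. H \<le> y \<Longrightarrow> P' (x, y) (0, 1) = 0"
    and en: "finite_energy_below E" "\<And>z. (min 0 (P' z (0, 1)))\<^sup>2 \<le> max 0 (E z)"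
  shows "P z = 0"
proof -
  define Q where "Q y = integral torus_cell (\<lambda>x. P (x, y))" for y
  define Q' where "Q' y = integral torus_cell (\<lambda>x. P' (x, y) (0, 1))" for y
  have c0: "continuous_on A P" for A
    using der by (meson continuous_at_imp_continuous_on has_derivative_continuous)
  have c1: "continuous_on A (\<lambda>z. P' z v)" for A v
    using der2 by (meson continuous_at_imp_continuous_on has_derivative_continuous)
  have c2: "continuous_on A (\<lambda>z. P'' v z u)" for A v u
    using cont2 by (rule continuous_on_subset) auto
  note cs = continuous_on_compose2[OF c0[of UNIV]] continuous_on_compose2[OF c1[of UNIV]]
    continuous_on_compose2[OF c2[of UNIV]]
  have dQ: "(Q has_real_derivative Q' y) (at y)" for y
    unfolding Q_def[abs_def] Q'_def
    by (rule torus_mean_second_derivative(1)[OF der der2 cont2 per])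
  have dQ': "\<exists>d. (Q' has_real_derivative d) (at y) \<and> 0 \<le> d" for y
  proof (intro exI conjI)
    show "(Q' has_real_derivative integral torus_cell (\<lambda>x. \<Sum>b\<in>Basis. P'' b (x, y) b)) (at y)"
      unfolding Q'_def[abs_def] by (rule torus_mean_second_derivative(2)[OF der der2 cont2 per])
    show "0 \<le> integral torus_cell (\<lambda>x. \<Sum>b\<in>Basis. P'' b (x, y) b)"
      unfolding torus_cell_def
      by (intro integral_nonneg integrable_continuous continuous_intros cs sub) auto
  qed
  have mono: "Q' y \<le> Q' y'" if "y \<le> y'" for y y'
    by (rule DERIV_nonneg_imp_nondecreasing[OF that]) (use dQ' in blast)
  have "Q' y \<le> 0" for y
    using mono[of y "max y H"] top(2) by (simp add: Q'_def)
  have "Q' y = 0" for y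
  proof (rule ccontr)
    assume "Q' y \<noteq> 0"
    with \<open>Q' y \<le> 0\<close> have neg: "Q' y < 0" by simp
    from en(1) obtain y0 C where E: "continuous_on (UNIV \<times> {..y0}) E"
      "\<And>x y. y \<le> y0 \<Longrightarrow> 0 \<le> E (x, y)" "\<And>R. integral (cbox (0, R) (two_pi, y0)) E \<le> C"
      by (auto simp: finite_energy_below_def)
    define y1 where "y1 = min y y0"
    define a where "a = - Q' y"
    define V where "V = measure lborel (torus_cell :: (real ^ 'n) set)"
    have "a > 0" using neg by (simp add: a_def)
    have "V > 0"
      unfolding V_def torus_cell_def by (simp add: content_pos_lt_eq Basis_vec_def inner_axis)
    \<comment> \<open>The optimal weight in \<open>2 u \<le> u\<^sup>2 / lam + lam\<close>, which stands in for the Cauchy-Schwarz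
      inequality on a slice of measure \<open>V\<close>.\<close>
    define lam where "lam = a / V"
    have "lam > 0" using \<open>a > 0\<close> \<open>V > 0\<close> by (simp add: lam_def)
    define N where "N z = (min 0 (P' z (0, 1)))\<^sup>2" for z
    have cN: "continuous_on A N" for A
      unfolding N_def by (intro continuous_intros cs) auto
    have iN: "(\<lambda>x. N (x, t)) integrable_on torus_cell" for t
      unfolding torus_cell_def
      by (intro integrable_continuous continuous_on_compose2[OF cN[of UNIV]] continuous_intros) auto
    have slice: "lam * a \<le> integral torus_cell (\<lambda>x. N (x, t))" if "t \<le> y1" for t
    proof -
      have "- P' z (0, 1) \<le> N z / (2 * lam) + lam / 2" for z
      proof -
        have "2 * lam * (- P' z (0, 1)) \<le> N z + lam\<^sup>2"
        proof (cases "P' z (0, 1) < 0")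
          case True
          then show ?thesis
            using zero_le_power2[of "P' z (0, 1) + lam"]
            by (simp add: N_def power2_sum algebra_simps)
        next
          case False
          then have "0 \<le> 2 * lam * P' z (0, 1)" "N z = 0"
            using \<open>lam > 0\<close> by (simp_all add: N_def min_absorb1)
          moreover have "0 \<le> lam\<^sup>2" by simp
          ultimately show ?thesis by linarith
        qed
        then show ?thesis using \<open>lam > 0\<close> by (simp add: field_simps power2_eq_square)
      qed
      then have "integral torus_cell (\<lambda>x. - P' (x, t) (0, 1))
          \<le> integral torus_cell (\<lambda>x. N (x, t) / (2 * lam) + lam / 2)"
        by (intro integral_le integrable_add integrable_on_divide iN integrable_neg)
          (auto simp: torus_cell_def intro!: integrable_continuous cs continuous_intros)
      also have "\<dots> = integral torus_cell (\<lambda>x. N (x, t)) / (2 * lam) + lam / 2 * V"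
        using iN[of t] by (subst integral_add) (auto simp: torus_cell_def V_def integrable_on_divide)
      finally have "a \<le> integral torus_cell (\<lambda>x. N (x, t)) / (2 * lam) + lam / 2 * V"
        using mono[of t y] that by (simp add: a_def Q'_def y1_def)
      moreover have "lam / 2 * V = a / 2" using \<open>V > 0\<close> by (simp add: lam_def)
      ultimately have "a / 2 \<le> integral torus_cell (\<lambda>x. N (x, t)) / (2 * lam)" by simp
      then show ?thesis using \<open>lam > 0\<close> by (simp add: field_simps)
    qed
    have bound: "lam * a * (y1 - R) \<le> C" if "R \<le> y1" for R
    proof -
      have cbox: "continuous_on (cbox (0, R) (two_pi, y1)) (\<lambda>(x, t). N (x, t))"
        using cN by simp
      have "lam * a * (y1 - R) = integral (cbox R y1) (\<lambda>t. lam * a)"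
        using that by simp
      also have "\<dots> \<le> integral (cbox R y1) (\<lambda>t. integral torus_cell (\<lambda>x. N (x, t)))"
      proof (rule integral_le)
        have "continuous_on UNIV (\<lambda>(t, x). N (x, t))"
          unfolding split_beta by (intro continuous_on_compose2[OF cN[of UNIV]] continuous_intros) auto
        then have "continuous_on (cbox (R, 0) (y1, two_pi)) (\<lambda>(t, x). N (x, t))"
          by (rule continuous_on_subset) auto
        from integral_integrable_2dim[OF this]
        show "(\<lambda>t. integral torus_cell (\<lambda>x. N (x, t))) integrable_on cbox R y1"
          by (simp add: torus_cell_def)
      qed (use slice in auto)
      also have "\<dots> = integral (cbox (0, R) (two_pi, y1)) N"
        using integral_swap_continuous[OF cbox] integral_prod_continuous[OF cN[of "cbox (0, R) (two_pi, y1)"]]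
        by (simp add: torus_cell_def)
      also have "\<dots> \<le> integral (cbox (0, R) (two_pi, y0)) E"
      proof -
        have cE: "continuous_on (cbox (0, R) (two_pi, y0)) E"
          by (rule continuous_on_subset[OF E(1)]) (auto simp: cbox_Pair_eq)
        have sub: "cbox (0, R) (two_pi, y1) \<subseteq> cbox (0 :: real ^ 'n, R) (two_pi, y0)"
          by (auto simp: cbox_Pair_eq y1_def)
        have "N z \<le> E z" if "z \<in> cbox (0, R) (two_pi, y1)" for z
          using en(2)[of z] E(2)[of "snd z" "fst z"] that
          by (auto simp: N_def cbox_Pair_eq y1_def)
        then have "integral (cbox (0, R) (two_pi, y1)) N \<le> integral (cbox (0, R) (two_pi, y1)) E"
          using cN cE sub by (intro integral_le integrable_continuous) (auto intro: continuous_on_subset)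
        also have "\<dots> \<le> integral (cbox (0, R) (two_pi, y0)) E"
          using cE sub E(2)
          by (intro integral_subset_le integrable_continuous) (auto intro: continuous_on_subset simp: cbox_Pair_eq)
        finally show ?thesis .
      qed
      also have "\<dots> \<le> C" by (rule E)
      finally show ?thesis .
    qed
    have "lam * a > 0" using \<open>lam > 0\<close> \<open>a > 0\<close> by simp
    \<comment> \<open>The depth is chosen so that the energy lower bound \<open>\<bar>C\<bar> + 1\<close> exceeds \<open>C\<close>.\<close>
    moreover have "lam * a * (y1 - (y1 - (\<bar>C\<bar> + 1) / (lam * a))) \<le> C"
      using \<open>lam * a > 0\<close> by (intro bound) simp
    ultimately show False
      using \<open>lam > 0\<close> \<open>a > 0\<close> by simp
  qed
  then have "Q y = Q (max y H)" for y
    using dQ by (intro DERIV_isconst_all) simp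
  then have Q0: "Q y = 0" for y
    using top(1) by (simp add: Q_def)
  obtain x y where z: "z = (x, y)" by fastforce
  have "continuous_on (cbox 0 two_pi) (\<lambda>x. P (x, y))"
    by (intro cs continuous_intros) auto
  moreover have "box 0 (two_pi :: real ^ 'n) \<noteq> {}"
    by (auto simp: box_ne_empty Basis_vec_def inner_axis)
  ultimately have "\<forall>x\<in>torus_cell. P (x, y) = 0"
    using integral_cbox_eq_0_iff[of 0 two_pi "\<lambda>x. P (x, y)"] Q0[of y] nonneg
    by (simp add: Q_def torus_cell_def)
  moreover obtain k where "x + (2 * pi) *\<^sub>R freq k \<in> torus_cell"
    using torus_cell_representative .
  ultimately have "P (x + (2 * pi) *\<^sub>R freq k, y) = 0"
    by blast
  then show ?thesis
    using torus_periodic_lattice[OF per, of x k y] z by simp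
qed

text \<open>
  If \<open>w\<close> is positive at some point, pick a level \<open>\<delta>\<close> strictly between 0 and that value. Since \<open>w \<le> 0\<close> on the graph
  and \<open>w\<close> is continuous up to it, the set \<open>{w \<ge> \<delta>}\<close> is closed in the whole space and lies in the open
  domain, so \<open>soft_ramp (w - \<delta>)\<close>, continued by zero, is a \<open>C\<^sup>2\<close> subharmonic function on the whole space. The
  previous lemma forces it to vanish. Only the negative part of \<open>\<partial>\<^sub>y w\<close> needs finite energy, because the
  mean slope that has to be excluded is negative; this one-sidedness is what admits \<open>w = y - \<phi>\<close> below.
\<close>

lemma fluid_maximum_principle:
  fixes w :: "(real ^ 'n) \<times> real \<Rightarrow> real"
  assumes h: "continuous_on UNIV h" "torus_periodic h"
    and cont: "continuous_on (closed_fluid_domain h) w"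
    and per: "\<And>y. torus_periodic (\<lambda>x. w (x, y))"
    and der: "\<And>z. z \<in> fluid_domain h \<Longrightarrow> (w has_derivative w' z) (at z)"
    and der2: "\<And>z v. z \<in> fluid_domain h \<Longrightarrow> ((\<lambda>z. w' z v) has_derivative w'' v z) (at z)"
    and cont2: "\<And>v u. continuous_on (fluid_domain h) (\<lambda>z. w'' v z u)"
    and harm: "\<And>z. z \<in> fluid_domain h \<Longrightarrow> (\<Sum>b\<in>Basis. w'' b z b) = 0"
    and bdry: "\<And>x. w (x, h x) \<le> 0"
    and en: "finite_energy_below E"
      "\<And>z. z \<in> fluid_domain h \<Longrightarrow> (min 0 (w' z (0, 1)))\<^sup>2 \<le> E z"
    and z: "z \<in> closed_fluid_domain h"
  shows "w z \<le> 0"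
proof (rule ccontr)
  assume "\<not> w z \<le> 0"
  define \<delta> where "\<delta> = w z / 2"
  have \<delta>: "0 < \<delta>" "\<delta> < w z" using \<open>\<not> w z \<le> 0\<close> by (auto simp: \<delta>_def)
  define \<Omega> where "\<Omega> = fluid_domain h"
  define U where "U = - (closed_fluid_domain h \<inter> w -` {\<delta>..})"
  have "open \<Omega>"
    unfolding \<Omega>_def by (rule open_fluid_domain[OF h(1)])
  have "open U"
    unfolding U_def
    by (intro open_Compl continuous_closed_preimage cont closed_closed_fluid_domain h) auto
  have boundary: "p \<in> \<Omega>" if "p \<in> closed_fluid_domain h" "0 < w p" for p
    using that bdry[of "fst p"]
    by (cases p) (auto simp: \<Omega>_def fluid_domain_def closed_fluid_domain_def order.order_iff_strict)
  have cover: "p \<in> \<Omega> \<or> p \<in> U" for p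
    using boundary[of p] \<delta>(1) by (auto simp: U_def)
  have low: "w p - \<delta> \<le> 0" if "p \<in> U" "p \<in> \<Omega>" for p
    using that by (auto simp: U_def \<Omega>_def closed_fluid_domain_def fluid_domain_def)
  define P where "P p = (if p \<in> \<Omega> then soft_ramp (w p - \<delta>) else 0)" for p
  define P' where "P' p v = (if p \<in> \<Omega> then soft_ramp' (w p - \<delta>) * w' p v else 0)" for p v
  define P'' where "P'' v p u = (if p \<in> \<Omega> then
      soft_ramp'' (w p - \<delta>) * w' p u * w' p v + soft_ramp' (w p - \<delta>) * w'' v p u else 0)" for v p u
  have PU: "P p = 0" "P' p = (\<lambda>v. 0)" "P'' v p = (\<lambda>u. 0)" if "p \<in> U" for p v
    using low[OF that] by (auto simp: P_def P'_def P''_def soft_ramp_simps fun_eq_iff)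
  have dP: "(P has_derivative P' p) (at p)" for p
  proof (cases "p \<in> \<Omega>")
    case True
    then have "((\<lambda>p. soft_ramp (w p - \<delta>)) has_derivative (\<lambda>v. soft_ramp' (w p - \<delta>) * w' p v)) (at p)"
      using has_derivative_compose[OF has_derivative_diff[OF der has_derivative_const]
          soft_ramp_deriv[unfolded has_field_derivative_def]]
      by (simp add: \<Omega>_def)
    then show ?thesis
      by (rule has_derivative_transform_within_open[OF _ \<open>open \<Omega>\<close> True, THEN has_derivative_eq_rhs])
        (auto simp: P_def P'_def True)
  next
    case False
    then have "p \<in> U" using cover by blast
    have "((\<lambda>p. 0) has_derivative P' p) (at p)"
      by (simp add: PU \<open>p \<in> U\<close>)
    then show ?thesis
      by (rule has_derivative_transform_within_open[OF _ \<open>open U\<close> \<open>p \<in> U\<close>]) (simp add: PU)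
  qed
  have dP': "((\<lambda>p. P' p v) has_derivative P'' v p) (at p)" for p v
  proof (cases "p \<in> \<Omega>")
    case True
    have "((\<lambda>p. soft_ramp' (w p - \<delta>)) has_derivative (\<lambda>u. soft_ramp'' (w p - \<delta>) * w' p u)) (at p)"
      using True has_derivative_compose[OF has_derivative_diff[OF der has_derivative_const]
          soft_ramp'_deriv[unfolded has_field_derivative_def]]
      by (simp add: \<Omega>_def)
    from has_derivative_mult[OF this der2[of p v]] True
    have "((\<lambda>p. soft_ramp' (w p - \<delta>) * w' p v) has_derivative (\<lambda>u. soft_ramp' (w p - \<delta>) * w'' v p u
        + soft_ramp'' (w p - \<delta>) * w' p u * w' p v)) (at p)"
      by (simp add: \<Omega>_def)
    moreover have "P'' v p = (\<lambda>u. soft_ramp' (w p - \<delta>) * w'' v p u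
        + soft_ramp'' (w p - \<delta>) * w' p u * w' p v)"
      using True by (simp add: P''_def fun_eq_iff)
    ultimately have "((\<lambda>p. soft_ramp' (w p - \<delta>) * w' p v) has_derivative P'' v p) (at p)"
      by simp
    then show ?thesis
      by (rule has_derivative_transform_within_open[OF _ \<open>open \<Omega>\<close> True]) (auto simp: P'_def)
  next
    case False
    then have "p \<in> U" using cover by blast
    have "((\<lambda>p. 0) has_derivative P'' v p) (at p)"
      by (simp add: PU \<open>p \<in> U\<close>)
    then show ?thesis
      by (rule has_derivative_transform_within_open[OF _ \<open>open U\<close> \<open>p \<in> U\<close>]) (simp add: PU)
  qed
  have cP'': "continuous_on UNIV (\<lambda>p. P'' v p u)" for v u
  proof -
    have "continuous_on \<Omega> (\<lambda>p. soft_ramp'' (w p - \<delta>) * w' p u * w' p v + soft_ramp' (w p - \<delta>) * w'' v p u)"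
    proof -
      have cw: "continuous_on \<Omega> w"
        unfolding \<Omega>_def
        by (intro continuous_at_imp_continuous_on ballI has_derivative_continuous[OF der])
      have cw': "continuous_on \<Omega> (\<lambda>p. w' p v)" for v
        unfolding \<Omega>_def
        by (intro continuous_at_imp_continuous_on ballI has_derivative_continuous[OF der2])
      have cr: "continuous_on UNIV soft_ramp'"
        using soft_ramp'_deriv by (intro continuous_at_imp_continuous_on ballI DERIV_isCont)
      show ?thesis
        by (intro continuous_intros cw cw' cont2[folded \<Omega>_def] continuous_on_compose2[OF cr]
            continuous_on_compose2[OF soft_ramp_simps(7)[of UNIV]]) auto
    qed
    then have "continuous_on \<Omega> (\<lambda>p. P'' v p u)"
      by (rule continuous_on_eq) (simp add: P''_def)
    moreover have "continuous_on U (\<lambda>p. P'' v p u)"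
      by (rule continuous_on_eq[of _ "\<lambda>p. 0"]) (auto simp: PU)
    ultimately have "continuous_on (\<Omega> \<union> U) (\<lambda>p. P'' v p u)"
      by (intro continuous_on_open_Un \<open>open \<Omega>\<close> \<open>open U\<close>)
    moreover have "\<Omega> \<union> U = UNIV"
      using cover by blast
    ultimately show ?thesis
      by simp
  qed
  obtain H where H: "\<And>x. h x \<le> H"
    using torus_periodic_bounded_above[OF h(2,1)] by blast
  have "P z = 0"
  proof (rule subharmonic_vanishes_of_finite_energy[where H = H and E = E, OF dP dP' cP''])
    show "torus_periodic (\<lambda>x. P (x, y))" for y
      using torus_periodicD[OF per] torus_periodicD[OF h(2)]
      by (simp add: torus_periodic_def P_def \<Omega>_def fluid_domain_def)
    show "0 \<le> (\<Sum>b\<in>Basis. P'' b p b)" for p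
    proof (cases "p \<in> \<Omega>")
      case True
      then have "(\<Sum>b\<in>Basis. P'' b p b)
          = (\<Sum>b\<in>Basis. soft_ramp'' (w p - \<delta>) * (w' p b)\<^sup>2) + soft_ramp' (w p - \<delta>) * (\<Sum>b\<in>Basis. w'' b p b)"
        by (simp add: P''_def sum.distrib sum_distrib_left power2_eq_square mult.assoc)
      also have "\<dots> \<ge> 0"
        using True by (simp add: harm \<Omega>_def sum_nonneg soft_ramp_simps)
      finally show ?thesis .
    qed (simp add: P''_def)
    show "0 \<le> P p" for p
      by (simp add: P_def soft_ramp_simps)
    show "P (x, y) = 0" "P' (x, y) (0, 1) = 0" if "H \<le> y" for x y
      using that H[of x] by (auto simp: P_def P'_def \<Omega>_def fluid_domain_def)
    show "finite_energy_below E" by (rule en)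
    show "(min 0 (P' p (0, 1)))\<^sup>2 \<le> max 0 (E p)" for p
    proof (cases "p \<in> \<Omega>")
      case True
      \<comment> \<open>The slope of \<open>soft_ramp\<close> lies in \<open>[0, 1]\<close>, so composing with it shrinks \<open>\<partial>\<^sub>y w\<close> and keeps its sign.\<close>
      define c where "c = soft_ramp' (w p - \<delta>)"
      have c: "0 \<le> c" "c \<le> 1" by (simp_all add: c_def soft_ramp_simps)
      have "min 0 (c * w' p (0, 1)) = c * min 0 (w' p (0, 1))"
        using c by (simp add: min_mult_distrib_left)
      then have "\<bar>min 0 (c * w' p (0, 1))\<bar> \<le> \<bar>min 0 (w' p (0, 1))\<bar>"
        using c mult_left_le_one_le[of "\<bar>min 0 (w' p (0, 1))\<bar>" c] by (simp only: abs_mult abs_of_nonneg abs_ge_zero)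
      moreover have "P' p (0, 1) = c * w' p (0, 1)"
        using True by (simp add: P'_def c_def)
      ultimately have "(min 0 (P' p (0, 1)))\<^sup>2 \<le> (min 0 (w' p (0, 1)))\<^sup>2"
        by (simp only: abs_le_square_iff)
      then show ?thesis
        using en(2)[of p] True by (simp add: \<Omega>_def)
    qed (simp add: P'_def)
  qed
  moreover have "z \<in> \<Omega>"
    using boundary[OF z] \<delta> by simp
  ultimately show False
    using \<delta> soft_ramp_simps(8)[of "w z - \<delta>"] by (simp add: P_def)
qed

section \<open>Comparison of harmonic extensions and of Dirichlet to Neumann maps\<close>

text \<open>
  Harmonicity with the derivatives as explicit functions (\<open>f'' v z u\<close> is the second derivative in
  directions \<open>v\<close> and \<open>u\<close>), so that differences and translates are computed termwise.
\<close>

definition C2_harmonic ::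
    "('a::euclidean_space \<Rightarrow> real) \<Rightarrow> ('a \<Rightarrow> 'a \<Rightarrow> real) \<Rightarrow> ('a \<Rightarrow> 'a \<Rightarrow> 'a \<Rightarrow> real) \<Rightarrow> 'a set \<Rightarrow> bool" where
  "C2_harmonic f f' f'' S \<longleftrightarrow>
     (\<forall>z\<in>S. (f has_derivative f' z) (at z)) \<and>
     (\<forall>z\<in>S. \<forall>v. ((\<lambda>z. f' z v) has_derivative f'' v z) (at z)) \<and>
     (\<forall>v u. continuous_on S (\<lambda>z. f'' v z u)) \<and>
     (\<forall>z\<in>S. (\<Sum>b\<in>Basis. f'' b z b) = 0)"

lemma C2_harmonicD:
  assumes "C2_harmonic f f' f'' S"
  shows "z \<in> S \<Longrightarrow> (f has_derivative f' z) (at z)"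
    and "z \<in> S \<Longrightarrow> ((\<lambda>z. f' z v) has_derivative f'' v z) (at z)"
    and "continuous_on S (\<lambda>z. f'' v z u)"
    and "z \<in> S \<Longrightarrow> (\<Sum>b\<in>Basis. f'' b z b) = 0"
  using assms by (auto simp: C2_harmonic_def)

text \<open>
  The Laplacian is defined by iterated derivatives along coordinate lines. Near \<open>z\<close> these lines stay in the
  open set \<open>S\<close>, where the first of these derivatives is given by \<open>f'\<close>.
\<close>

lemma harmonic_on_derivatives:
  assumes harm: "harmonic_on f S" and S: "open S"
  obtains f' f'' where "C2_harmonic f f' f'' S"
proof -
  from harm obtain f' where f': "\<And>z. z \<in> S \<Longrightarrow> (f has_derivative f' z) (at z within S)"
    and ck: "\<And>v. Ck_on (Suc 0) (\<lambda>z. f' z v) S"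
    by (auto simp: harmonic_on_def numeral_2_eq_2)
  from ck have "\<forall>v. \<exists>g. (\<forall>z\<in>S. ((\<lambda>z. f' z v) has_derivative g z) (at z within S)) \<and>
      (\<forall>u. continuous_on S (\<lambda>z. g z u))"
    by simp
  then obtain f'' where f'': "\<And>v z. z \<in> S \<Longrightarrow> ((\<lambda>z. f' z v) has_derivative f'' v z) (at z within S)"
    and c: "\<And>v u. continuous_on S (\<lambda>z. f'' v z u)"
    by metis
  have d1: "(f has_derivative f' z) (at z)" if "z \<in> S" for z
    using f'[OF that] by (simp add: at_within_open[OF that S])
  have d2: "((\<lambda>z. f' z v) has_derivative f'' v z) (at z)" if "z \<in> S" for z v
    using f''[OF that] by (simp add: at_within_open[OF that S])
  have "(\<Sum>b\<in>Basis. f'' b z b) = 0" if z: "z \<in> S" for z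
  proof -
    have "deriv (deriv (\<lambda>r. f (z + r *\<^sub>R b))) 0 = f'' b z b" for b
    proof (rule DERIV_imp_deriv)
      have op: "open ((\<lambda>r::real. z + r *\<^sub>R b) -` S)"
        by (intro open_vimage S continuous_intros)
      have der: "((\<lambda>r. f' (z + r *\<^sub>R b) b) has_real_derivative f'' b z b) (at 0)"
        by (rule has_derivative_along_line) (use d2[OF z] in simp)
      have eq: "f' (z + r *\<^sub>R b) b = deriv (\<lambda>r. f (z + r *\<^sub>R b)) r"
        if "r \<in> (\<lambda>r::real. z + r *\<^sub>R b) -` S" for r
        using that by (intro DERIV_imp_deriv[symmetric] has_derivative_along_line d1) simp
      show "(deriv (\<lambda>r. f (z + r *\<^sub>R b)) has_real_derivative f'' b z b) (at 0)"
        by (rule has_field_derivative_transform_within_open[OF der op _ eq]) (use z in auto)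
    qed
    then have "(\<Sum>b\<in>Basis. f'' b z b) = laplacian f z"
      by (simp add: laplacian_def)
    then show ?thesis
      using harm z by (simp add: harmonic_on_def)
  qed
  with d1 d2 c show thesis
    by (intro that) (auto simp: C2_harmonic_def)
qed

text \<open>
  As \<open>E \<ge> 0\<close>, lowering the top of the boxes keeps the bound; this lets several densities share one top.
\<close>

lemma finite_energy_belowE:
  assumes "finite_energy_below E"
  obtains y1 C where "\<And>y0. y0 \<le> y1 \<Longrightarrow> continuous_on (UNIV \<times> {..y0}) E"
    "\<And>x y. y \<le> y1 \<Longrightarrow> 0 \<le> E (x, y)"
    "\<And>R y0. y0 \<le> y1 \<Longrightarrow> integral (cbox (0, R) (two_pi, y0)) E \<le> C"
proof -
  from assms obtain y1 C where E: "continuous_on (UNIV \<times> {..y1}) E" "\<And>x y. y \<le> y1 \<Longrightarrow> 0 \<le> E (x, y)"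
    "\<And>R. integral (cbox (0, R) (two_pi, y1)) E \<le> C"
    by (auto simp: finite_energy_below_def)
  have "integral (cbox (0, R) (two_pi, y0)) E \<le> C" if "y0 \<le> y1" for R y0
  proof -
    have int: "E integrable_on cbox (0, R) (two_pi, y)" if "y \<le> y1" for y
      using that by (intro integrable_continuous continuous_on_subset[OF E(1)]) (auto simp: cbox_Pair_eq)
    have "integral (cbox (0, R) (two_pi, y0)) E \<le> integral (cbox (0, R) (two_pi, y1)) E"
      using that E(2) by (intro integral_subset_le int) (auto simp: cbox_Pair_eq)
    then show ?thesis
      using E(3)[of R] by linarith
  qed
  then show thesis
    using E by (intro that[of y1 C]) (auto intro: continuous_on_subset)
qed

text \<open>
  The factors 2 are those of \<open>(a - b)\<^sup>2 \<le> 2 a\<^sup>2 + 2 b\<^sup>2\<close>.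
\<close>

lemma finite_energy_below_add:
  assumes "finite_energy_below E" "finite_energy_below F"
  shows "finite_energy_below (\<lambda>z. 2 * E z + 2 * F z)"
proof -
  obtain y1 C where E: "\<And>y0. y0 \<le> y1 \<Longrightarrow> continuous_on (UNIV \<times> {..y0}) E"
    "\<And>x y. y \<le> y1 \<Longrightarrow> 0 \<le> E (x, y)"
    "\<And>R y0. y0 \<le> y1 \<Longrightarrow> integral (cbox (0, R) (two_pi, y0)) E \<le> C"
    using finite_energy_belowE[OF assms(1)] by metis
  obtain y2 D where F: "\<And>y0. y0 \<le> y2 \<Longrightarrow> continuous_on (UNIV \<times> {..y0}) F"
    "\<And>x y. y \<le> y2 \<Longrightarrow> 0 \<le> F (x, y)"
    "\<And>R y0. y0 \<le> y2 \<Longrightarrow> integral (cbox (0, R) (two_pi, y0)) F \<le> D"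
    using finite_energy_belowE[OF assms(2)] by metis
  let ?y = "min y1 y2"
  have c: "continuous_on (UNIV \<times> {..?y}) E" "continuous_on (UNIV \<times> {..?y}) F"
    by (auto intro: E F)
  have "integral (cbox (0, R) (two_pi, ?y)) (\<lambda>z. 2 * E z + 2 * F z) \<le> 2 * C + 2 * D" for R
  proof -
    have "cbox (0, R) (two_pi, ?y) \<subseteq> UNIV \<times> {..?y}"
      by (auto simp: cbox_Pair_eq)
    then have int: "E integrable_on cbox (0, R) (two_pi, ?y)" "F integrable_on cbox (0, R) (two_pi, ?y)"
      using c by (auto intro!: integrable_continuous intro: continuous_on_subset)
    have "integral (cbox (0, R) (two_pi, ?y)) (\<lambda>z. 2 * E z + 2 * F z)
        = 2 * integral (cbox (0, R) (two_pi, ?y)) E + 2 * integral (cbox (0, R) (two_pi, ?y)) F"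
      using int by (subst integral_add) (auto intro: integrable_on_mult_right)
    then show ?thesis
      using E(3)[of ?y R] F(3)[of ?y R] by simp
  qed
  moreover have "continuous_on (UNIV \<times> {..?y}) (\<lambda>z. 2 * E z + 2 * F z)"
    by (intro continuous_intros c)
  moreover have "\<forall>x. \<forall>y\<le>?y. 0 \<le> 2 * E (x, y) + 2 * F (x, y)"
    using E(2) F(2) by simp
  ultimately show ?thesis
    unfolding finite_energy_below_def by blast
qed

lemma finite_energy_below_shift:
  fixes E :: "(real ^ 'n) \<times> real \<Rightarrow> real"
  assumes "finite_energy_below E"
  shows "finite_energy_below (\<lambda>z. E (z - (0, c)))"
proof -
  obtain y1 C where E: "\<And>y0. y0 \<le> y1 \<Longrightarrow> continuous_on (UNIV \<times> {..y0}) E"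
    "\<And>x y. y \<le> y1 \<Longrightarrow> 0 \<le> E (x, y)"
    "\<And>R y0. y0 \<le> y1 \<Longrightarrow> integral (cbox (0, R) (two_pi, y0)) E \<le> C"
    using finite_energy_belowE[OF assms(1)] by metis
  have "integral (cbox (0, R) (two_pi, y1 + c)) (\<lambda>z. E (z - (0, c))) \<le> C" for R
  proof -
    have "E \<circ> (+) (0, - c) = (\<lambda>z. E (z - (0, c)))"
      by (auto simp: fun_eq_iff)
    then show ?thesis
      using integral_shift_cbox_plus[of "(0, R)" "(two_pi, y1 + c)" E "(0, - c)"] E(3)[of y1 "R - c"]
      by simp
  qed
  moreover have "continuous_on (UNIV \<times> {..y1 + c}) (\<lambda>z. E (z - (0, c)))"
    by (rule continuous_on_compose2[OF E(1)[of y1]]) (auto intro!: continuous_intros)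
  moreover have "\<forall>x. \<forall>y\<le>y1 + c. 0 \<le> E ((x, y) - (0, c))"
    using E(2) by simp
  ultimately show ?thesis
    unfolding finite_energy_below_def by blast
qed

text \<open>
  Below the minimum of \<open>h\<close> every box of width one period lies in the domain, and there
  \<open>(\<partial>\<^sub>y \<phi>)\<^sup>2 \<le> \<bar>\<nabla>\<phi>\<bar>\<^sup>2\<close>.
\<close>

lemma harmonic_extension_finite_energy:
  fixes h :: "real ^ 'n \<Rightarrow> real"
  assumes ext: "harmonic_extension h \<psi> \<phi>" and C2: "C2_harmonic \<phi> \<phi>' \<phi>'' (fluid_domain h)"
    and h: "continuous_on UNIV h" "torus_periodic h"
  shows "finite_energy_below (\<lambda>z. (\<phi>' z (0, 1))\<^sup>2)"
proof -
  let ?A = "fluid_domain h \<inter> torus_cell \<times> UNIV"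
  from ext obtain grad where grad: "\<And>z. z \<in> fluid_domain h \<Longrightarrow> GDERIV \<phi> z :> grad z"
    and int: "set_integrable lebesgue ?A (\<lambda>z. (norm (grad z))\<^sup>2)"
    by (auto simp: harmonic_extension_def)
  have eq: "\<phi>' z = (\<lambda>v. v \<bullet> grad z)" if "z \<in> fluid_domain h" for z
    using C2_harmonicD(1)[OF C2 that] grad[OF that] has_derivative_unique
    unfolding gderiv_def by blast
  have le: "(\<phi>' z (0, 1))\<^sup>2 \<le> (norm (grad z))\<^sup>2" if "z \<in> fluid_domain h" for z
    using Cauchy_Schwarz_ineq2[of "(0, 1)" "grad z"]
    by (simp add: eq[OF that] abs_le_square_iff[symmetric] norm_Pair)
  obtain B where B: "\<And>x. - h x \<le> B"
    using torus_periodic_bounded_above[of "\<lambda>x. - h x"] h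
    by (auto simp: torus_periodic_def intro: continuous_intros)
  define y0 where "y0 = - B - 1"
  have below: "(x, y) \<in> fluid_domain h" if "y \<le> y0" for x y
    using B[of x] that by (simp add: fluid_domain_def y0_def)
  have cont: "continuous_on (fluid_domain h) (\<lambda>z. (\<phi>' z (0, 1))\<^sup>2)"
    by (intro continuous_intros continuous_at_imp_continuous_on ballI has_derivative_continuous[OF C2_harmonicD(2)[OF C2]])
  have "integral (cbox (0, R) (two_pi, y0)) (\<lambda>z. (\<phi>' z (0, 1))\<^sup>2) \<le> integral ?A (\<lambda>z. (norm (grad z))\<^sup>2)" for R
  proof -
    have sub: "cbox (0, R) (two_pi, y0) \<subseteq> ?A"
      using below by (auto simp: cbox_Pair_eq torus_cell_def)
    have intA: "(\<lambda>z. (norm (grad z))\<^sup>2) integrable_on ?A"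
      using int by (rule set_lebesgue_integral_eq_integral(1))
    have intR: "(\<lambda>z. (norm (grad z))\<^sup>2) integrable_on cbox (0, R) (two_pi, y0)"
      by (rule set_lebesgue_integral_eq_integral(1)[OF set_integrable_subset[OF int _ sub]]) simp
    have "integral (cbox (0, R) (two_pi, y0)) (\<lambda>z. (\<phi>' z (0, 1))\<^sup>2)
        \<le> integral (cbox (0, R) (two_pi, y0)) (\<lambda>z. (norm (grad z))\<^sup>2)"
      using sub le by (intro integral_le intR integrable_continuous continuous_on_subset[OF cont]) auto
    also have "\<dots> \<le> integral ?A (\<lambda>z. (norm (grad z))\<^sup>2)"
      by (intro integral_subset_le sub intR intA) auto
    finally show ?thesis .
  qed
  moreover have "continuous_on (UNIV \<times> {..y0}) (\<lambda>z. (\<phi>' z (0, 1))\<^sup>2)"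
    using below by (intro continuous_on_subset[OF cont]) auto
  ultimately show ?thesis
    unfolding finite_energy_below_def by (intro exI conjI allI) auto
qed

lemma C2_harmonic_subset: "C2_harmonic f f' f'' T \<Longrightarrow> S \<subseteq> T \<Longrightarrow> C2_harmonic f f' f'' S"
  unfolding C2_harmonic_def by (meson continuous_on_subset subsetD)

lemma C2_harmonic_diff:
  assumes "C2_harmonic f f' f'' S" "C2_harmonic g g' g'' S"
  shows "C2_harmonic (\<lambda>z. f z - g z) (\<lambda>z v. f' z v - g' z v) (\<lambda>v z u. f'' v z u - g'' v z u) S"
  using assms unfolding C2_harmonic_def
  by (auto intro!: has_derivative_diff continuous_intros simp: sum_subtractf)

lemma C2_harmonic_linear:
  assumes "bounded_linear L"
  shows "C2_harmonic L (\<lambda>z. L) (\<lambda>v z u. 0) S"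
  using assms by (auto simp: C2_harmonic_def bounded_linear_imp_has_derivative)

lemma C2_harmonic_translate:
  assumes "C2_harmonic f f' f'' S"
  shows "C2_harmonic (\<lambda>z. f (z - p) + c) (\<lambda>z. f' (z - p)) (\<lambda>v z. f'' v (z - p)) ((+) p ` S)"
proof -
  have shift: "((\<lambda>z. F (z - p)) has_derivative F') (at (p + z))"
    if "(F has_derivative F') (at z)" for F :: "'a \<Rightarrow> real" and F' z
    by (rule has_derivative_compose[of "\<lambda>z. z - p" "\<lambda>z. z" _ _ F])
      (use that in \<open>auto intro!: derivative_eq_intros\<close>)
  show ?thesis
    unfolding C2_harmonic_def
  proof (intro conjI ballI allI)
    fix z assume "z \<in> (+) p ` S"
    then obtain y where y: "z = p + y" "y \<in> S" by blast
    show "((\<lambda>z. f (z - p) + c) has_derivative f' (z - p)) (at z)"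
      using has_derivative_add[OF shift[OF C2_harmonicD(1)[OF assms y(2)]] has_derivative_const[of c]]
      by (simp add: y)
    show "((\<lambda>z. f' (z - p) v) has_derivative f'' v (z - p)) (at z)" for v
      using shift[OF C2_harmonicD(2)[OF assms y(2)]] by (simp add: y)
    show "(\<Sum>b\<in>Basis. f'' b (z - p) b) = 0"
      using C2_harmonicD(4)[OF assms y(2)] by (simp add: y)
  next
    show "continuous_on ((+) p ` S) (\<lambda>z. f'' v (z - p) u)" for v u
      by (rule continuous_on_compose2[OF C2_harmonicD(3)[OF assms, of v u]])
        (auto intro!: continuous_intros)
  qed
qed

text \<open>
  The function \<open>w = y - \<phi>\<close> is harmonic and vanishes on the graph. Its gradient has infinite energy, but
  \<open>\<partial>\<^sub>y w = 1 - \<partial>\<^sub>y \<phi>\<close> is negative only where \<open>\<partial>\<^sub>y \<phi> > 1\<close>, and there its square is at most \<open>(\<partial>\<^sub>y \<phi>)\<^sup>2\<close>.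
\<close>

lemma harmonic_extension_above_height:
  fixes h :: "real ^ 'n \<Rightarrow> real"
  assumes ext: "harmonic_extension h h \<phi>"
    and h: "continuous_on UNIV h" "torus_periodic h"
    and z: "(x, y) \<in> closed_fluid_domain h"
  shows "y \<le> \<phi> (x, y)"
proof -
  from ext have harm: "harmonic_on \<phi> (fluid_domain h)"
    and per: "\<And>y. torus_periodic (\<lambda>x. \<phi> (x, y))"
    and cont: "continuous_on (closed_fluid_domain h) \<phi>"
    and bdry: "\<And>x. \<phi> (x, h x) = h x"
    by (auto simp: harmonic_extension_def)
  obtain \<phi>' \<phi>'' where C2: "C2_harmonic \<phi> \<phi>' \<phi>'' (fluid_domain h)"
    using harmonic_on_derivatives[OF harm open_fluid_domain[OF h(1)]] .
  note v = C2_harmonic_diff[OF C2_harmonic_linear[OF bounded_linear_snd] C2]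
  have "snd (x, y) - \<phi> (x, y) \<le> 0"
  proof (rule fluid_maximum_principle[OF h _ _ C2_harmonicD[OF v] _ harmonic_extension_finite_energy[OF ext C2 h] _ z])
    show "continuous_on (closed_fluid_domain h) (\<lambda>z. snd z - \<phi> z)"
      by (intro continuous_intros cont)
    show "torus_periodic (\<lambda>x. snd (x, y) - \<phi> (x, y))" for y
      using per by (simp add: torus_periodic_def)
    show "(min 0 (snd (0, 1) - \<phi>' z (0, 1)))\<^sup>2 \<le> (\<phi>' z (0, 1))\<^sup>2" for z
      by (rule abs_le_square_iff[THEN iffD1]) (simp add: min_def abs_if)
  qed (simp_all add: bdry)
  then show ?thesis by simp
qed

text \<open>
  The translate \<open>\<phi>\<^sub>2 (x, y - c) + c\<close> is the harmonic extension of \<open>h\<^sub>2 + c\<close>, whose domain contains that of \<open>h\<^sub>1\<close>.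
  By the previous lemma it is at least \<open>y\<close>, hence on the graph of \<open>h\<^sub>1\<close> it is at least \<open>h\<^sub>1 = \<phi>\<^sub>1\<close>. The
  maximum principle carries this inequality into the domain of \<open>h\<^sub>1\<close>.
\<close>

lemma harmonic_extension_comparison:
  fixes h\<^sub>1 h\<^sub>2 :: "real ^ 'n \<Rightarrow> real"
  assumes ext1: "harmonic_extension h\<^sub>1 h\<^sub>1 \<phi>\<^sub>1" and ext2: "harmonic_extension h\<^sub>2 h\<^sub>2 \<phi>\<^sub>2"
    and h1: "continuous_on UNIV h\<^sub>1" "torus_periodic h\<^sub>1"
    and h2: "continuous_on UNIV h\<^sub>2" "torus_periodic h\<^sub>2"
    and le: "\<And>x. h\<^sub>1 x \<le> h\<^sub>2 x + c"
    and z: "(x, y) \<in> closed_fluid_domain h\<^sub>1"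
  shows "\<phi>\<^sub>1 (x, y) \<le> \<phi>\<^sub>2 (x, y - c) + c"
proof -
  from ext1 have harm1: "harmonic_on \<phi>\<^sub>1 (fluid_domain h\<^sub>1)"
    and per1: "\<And>y. torus_periodic (\<lambda>x. \<phi>\<^sub>1 (x, y))"
    and cont1: "continuous_on (closed_fluid_domain h\<^sub>1) \<phi>\<^sub>1"
    and bdry1: "\<And>x. \<phi>\<^sub>1 (x, h\<^sub>1 x) = h\<^sub>1 x"
    by (auto simp: harmonic_extension_def)
  from ext2 have harm2: "harmonic_on \<phi>\<^sub>2 (fluid_domain h\<^sub>2)"
    and per2: "\<And>y. torus_periodic (\<lambda>x. \<phi>\<^sub>2 (x, y))"
    and cont2: "continuous_on (closed_fluid_domain h\<^sub>2) \<phi>\<^sub>2"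
    by (auto simp: harmonic_extension_def)
  obtain \<phi>\<^sub>1' \<phi>\<^sub>1'' where C1: "C2_harmonic \<phi>\<^sub>1 \<phi>\<^sub>1' \<phi>\<^sub>1'' (fluid_domain h\<^sub>1)"
    using harmonic_on_derivatives[OF harm1 open_fluid_domain[OF h1(1)]] .
  obtain \<phi>\<^sub>2' \<phi>\<^sub>2'' where C2: "C2_harmonic \<phi>\<^sub>2 \<phi>\<^sub>2' \<phi>\<^sub>2'' (fluid_domain h\<^sub>2)"
    using harmonic_on_derivatives[OF harm2 open_fluid_domain[OF h2(1)]] .
  have sub: "fluid_domain h\<^sub>1 \<subseteq> (+) (0, c) ` fluid_domain h\<^sub>2"
  proof
    fix z assume "z \<in> fluid_domain h\<^sub>1"
    then have "z - (0, c) \<in> fluid_domain h\<^sub>2"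
      using le[of "fst z"] by (cases z) (auto simp: fluid_domain_def)
    then show "z \<in> (+) (0, c) ` fluid_domain h\<^sub>2"
      by (intro image_eqI[of _ _ "z - (0, c)"]) simp_all
  qed
  note w = C2_harmonic_diff[OF C1 C2_harmonic_subset[OF C2_harmonic_translate[OF C2, of "(0, c)" c] sub]]
  note en = finite_energy_below_add[OF harmonic_extension_finite_energy[OF ext1 C1 h1]
      finite_energy_below_shift[OF harmonic_extension_finite_energy[OF ext2 C2 h2], of c]]
  have "\<phi>\<^sub>1 (x, y) - (\<phi>\<^sub>2 ((x, y) - (0, c)) + c) \<le> 0"
  proof (rule fluid_maximum_principle[OF h1 _ _ C2_harmonicD[OF w] _ en _ z])
    show "continuous_on (closed_fluid_domain h\<^sub>1) (\<lambda>z. \<phi>\<^sub>1 z - (\<phi>\<^sub>2 (z - (0, c)) + c))"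
    proof (intro continuous_intros cont1 continuous_on_compose2[OF cont2])
      show "(\<lambda>z. z - (0, c)) ` closed_fluid_domain h\<^sub>1 \<subseteq> closed_fluid_domain h\<^sub>2"
        using le by (auto simp: closed_fluid_domain_def) (smt (verit))
    qed
    show "torus_periodic (\<lambda>x. \<phi>\<^sub>1 (x, y) - (\<phi>\<^sub>2 ((x, y) - (0, c)) + c))" for y
      using per1 per2 by (simp add: torus_periodic_def)
    show "\<phi>\<^sub>1 (x, h\<^sub>1 x) - (\<phi>\<^sub>2 ((x, h\<^sub>1 x) - (0, c)) + c) \<le> 0" for x
      using harmonic_extension_above_height[OF ext2 h2, of x "h\<^sub>1 x - c"] le[of x]
      by (simp add: bdry1 closed_fluid_domain_def)
    show "(min 0 (\<phi>\<^sub>1' z (0, 1) - \<phi>\<^sub>2' (z - (0, c)) (0, 1)))\<^sup>2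
        \<le> 2 * (\<phi>\<^sub>1' z (0, 1))\<^sup>2 + 2 * (\<phi>\<^sub>2' (z - (0, c)) (0, 1))\<^sup>2" for z
    proof -
      have "(min 0 (a - b))\<^sup>2 \<le> 2 * a\<^sup>2 + 2 * b\<^sup>2" for a b :: real
      proof -
        have "(min 0 (a - b))\<^sup>2 \<le> (a - b)\<^sup>2"
          by (rule abs_le_square_iff[THEN iffD1]) (simp add: min_def abs_if)
        also have "\<dots> \<le> (a - b)\<^sup>2 + (a + b)\<^sup>2" by simp
        also have "\<dots> = 2 * a\<^sup>2 + 2 * b\<^sup>2" by (simp add: power2_eq_square algebra_simps)
        finally show ?thesis .
      qed
      then show ?thesis .
    qed
  qed
  then show ?thesis by simp
qed

lemma has_dirichlet_neumann_continuous:
  "has_dirichlet_neumann h \<psi> g \<Longrightarrow> continuous_on UNIV h"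
  unfolding has_dirichlet_neumann_def gderiv_def
  by (meson continuous_at_imp_continuous_on has_derivative_continuous)

text \<open>
  At a contact point the two graphs have the same tangent plane, so both Dirichlet to Neumann values
  are derivatives along the same outward normal \<open>(-D\<^sub>1, 1)\<close>. The difference \<open>\<phi>\<^sub>1 - \<phi>\<^sub>2\<close> of the (translated)
  extensions vanishes at that point and is nonpositive in the domain of \<open>h\<^sub>1\<close>, so it does not increase
  in the inward direction \<open>(D\<^sub>1, -1)\<close>.
\<close>

lemma dirichlet_neumann_contact:
  fixes h\<^sub>1 h\<^sub>2 :: "real ^ 'n \<Rightarrow> real"
  assumes dn1: "has_dirichlet_neumann h\<^sub>1 h\<^sub>1 g\<^sub>1" and dn2: "has_dirichlet_neumann h\<^sub>2 h\<^sub>2 g\<^sub>2"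
    and per: "torus_periodic h\<^sub>1" "torus_periodic h\<^sub>2"
    and le: "\<And>x. h\<^sub>1 x \<le> h\<^sub>2 x + c" and eq: "h\<^sub>1 x0 = h\<^sub>2 x0 + c"
  shows "g\<^sub>2 x0 \<le> g\<^sub>1 x0"
proof -
  from dn1 obtain \<phi>\<^sub>1 D\<^sub>1 N\<^sub>1 where 1: "harmonic_extension h\<^sub>1 h\<^sub>1 \<phi>\<^sub>1" "GDERIV h\<^sub>1 x0 :> D\<^sub>1"
    "(\<phi>\<^sub>1 has_derivative (\<lambda>v. v \<bullet> N\<^sub>1)) (at (x0, h\<^sub>1 x0) within closed_fluid_domain h\<^sub>1)"
    "g\<^sub>1 x0 = snd N\<^sub>1 - D\<^sub>1 \<bullet> fst N\<^sub>1"
    unfolding has_dirichlet_neumann_def by metis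
  from dn2 obtain \<phi>\<^sub>2 D\<^sub>2 N\<^sub>2 where 2: "harmonic_extension h\<^sub>2 h\<^sub>2 \<phi>\<^sub>2" "GDERIV h\<^sub>2 x0 :> D\<^sub>2"
    "(\<phi>\<^sub>2 has_derivative (\<lambda>v. v \<bullet> N\<^sub>2)) (at (x0, h\<^sub>2 x0) within closed_fluid_domain h\<^sub>2)"
    "g\<^sub>2 x0 = snd N\<^sub>2 - D\<^sub>2 \<bullet> fst N\<^sub>2"
    unfolding has_dirichlet_neumann_def by metis
  have "((\<lambda>x. h\<^sub>1 x - h\<^sub>2 x) has_derivative (\<lambda>v. v \<bullet> D\<^sub>1 - v \<bullet> D\<^sub>2)) (at x0)"
    using 1(2) 2(2) unfolding gderiv_def by (rule has_derivative_diff)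
  then have "(\<lambda>v. v \<bullet> D\<^sub>1 - v \<bullet> D\<^sub>2) = (\<lambda>v. 0)"
    by (rule differential_zero_maxmin[of x0 UNIV, rotated 2]) (use le eq in \<open>auto simp: algebra_simps\<close>)
  then have "(D\<^sub>1 - D\<^sub>2) \<bullet> (D\<^sub>1 - D\<^sub>2) = 0"
    by (metis inner_diff_right)
  then have D: "D\<^sub>2 = D\<^sub>1" by simp
  define p where "p s = (x0 + s *\<^sub>R D\<^sub>1, h\<^sub>1 x0 - s)" for s
  \<comment> \<open>The inward path stays in the fluid: its height above the graph decreases at rate \<open>\<bar>D\<^sub>1\<bar>\<^sup>2 + 1 > 0\<close>.\<close>
  have "((\<lambda>s. h\<^sub>1 (x0 + s *\<^sub>R D\<^sub>1) + s) has_real_derivative D\<^sub>1 \<bullet> D\<^sub>1 + 1) (at 0)"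
    using has_derivative_along_line[of h\<^sub>1 "\<lambda>v. v \<bullet> D\<^sub>1" x0 0 D\<^sub>1] 1(2)
    by (auto simp: gderiv_def intro!: derivative_eq_intros)
  then obtain d where d: "d > 0"
    "\<And>s. 0 < s \<Longrightarrow> s < d \<Longrightarrow> h\<^sub>1 x0 < h\<^sub>1 (x0 + s *\<^sub>R D\<^sub>1) + s"
    using DERIV_pos_inc_right[of "\<lambda>s. h\<^sub>1 (x0 + s *\<^sub>R D\<^sub>1) + s" "D\<^sub>1 \<bullet> D\<^sub>1 + 1" 0]
    by (auto simp: add_nonneg_pos)
  have inside: "p s \<in> closed_fluid_domain h\<^sub>1" if "s \<in> {0..<d}" for s
    using d(2)[of s] that by (cases "s = 0") (auto simp: p_def closed_fluid_domain_def)
  have below: "p s - (0, c) \<in> closed_fluid_domain h\<^sub>2" if "s \<in> {0..<d}" for s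
    using inside[OF that] le[of "x0 + s *\<^sub>R D\<^sub>1"] by (simp add: p_def closed_fluid_domain_def)
  have dp: "(p has_derivative (\<lambda>s. s *\<^sub>R (D\<^sub>1, - 1))) (at 0 within {0..<d})"
    unfolding p_def by (auto intro!: derivative_eq_intros)
  have dp': "((\<lambda>s. p s - (0, c)) has_derivative (\<lambda>s. s *\<^sub>R (D\<^sub>1, - 1))) (at 0 within {0..<d})"
    using has_derivative_diff[OF dp has_derivative_const[of "(0, c)"]] by simp
  define u where "u s = \<phi>\<^sub>1 (p s) - (\<phi>\<^sub>2 (p s - (0, c)) + c)" for s
  have "((\<lambda>s. \<phi>\<^sub>1 (p s)) has_derivative (\<lambda>s. (s *\<^sub>R (D\<^sub>1, - 1)) \<bullet> N\<^sub>1)) (at 0 within {0..<d})"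
    by (rule has_derivative_in_compose[OF dp has_derivative_subset])
      (use 1(3) inside in \<open>auto simp: p_def\<close>)
  moreover have "((\<lambda>s. \<phi>\<^sub>2 (p s - (0, c))) has_derivative (\<lambda>s. (s *\<^sub>R (D\<^sub>1, - 1)) \<bullet> N\<^sub>2)) (at 0 within {0..<d})"
    by (rule has_derivative_in_compose[OF dp' has_derivative_subset])
      (use 2(3) below eq in \<open>auto simp: p_def\<close>)
  ultimately have "(u has_derivative (\<lambda>s. (s *\<^sub>R (D\<^sub>1, - 1)) \<bullet> N\<^sub>1 - ((s *\<^sub>R (D\<^sub>1, - 1)) \<bullet> N\<^sub>2 + 0))) (at 0 within {0..<d})"
    unfolding u_def[abs_def] by (intro has_derivative_diff has_derivative_add has_derivative_const)
  moreover have "(\<lambda>s. (s *\<^sub>R (D\<^sub>1, - 1)) \<bullet> N\<^sub>1 - ((s *\<^sub>R (D\<^sub>1, - 1)) \<bullet> N\<^sub>2 + 0)) = (*) (g\<^sub>2 x0 - g\<^sub>1 x0)"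
    by (simp add: fun_eq_iff 1(4) 2(4) D inner_prod_def algebra_simps)
  ultimately have du: "(u has_real_derivative g\<^sub>2 x0 - g\<^sub>1 x0) (at 0 within {0..<d})"
    by (simp add: has_field_derivative_def)
  have "\<phi>\<^sub>1 (x0, h\<^sub>1 x0) = h\<^sub>1 x0" "\<phi>\<^sub>2 (x0, h\<^sub>2 x0) = h\<^sub>2 x0"
    using 1(1) 2(1) by (auto simp: harmonic_extension_def)
  then have u0: "u 0 = 0"
    using eq by (simp add: u_def p_def)
  have u_le: "u s \<le> 0" if "s \<in> {0..<d}" for s
    using harmonic_extension_comparison[OF 1(1) 2(1) has_dirichlet_neumann_continuous[OF dn1] per(1) has_dirichlet_neumann_continuous[OF dn2] per(2) le] inside[OF that]
    by (simp add: u_def p_def)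
  show ?thesis
  proof (rule ccontr)
    assume "\<not> ?thesis"
    then obtain r where r: "r > 0" "\<And>s. 0 < s \<Longrightarrow> 0 + s \<in> {0..<d} \<Longrightarrow> s < r \<Longrightarrow> u 0 < u (0 + s)"
      using has_real_derivative_pos_inc_right[OF du] by auto
    define s where "s = min r d / 2"
    have "0 < s" "s < d" "s < r"
      using r(1) d(1) by (auto simp: s_def)
    then show False
      using r(2)[of s] u_le[of s] u0 by simp
  qed
qed

section \<open>Trigonometric polynomials and Fourier coefficients\<close>

lemma continuous_on_character: "continuous_on A (\<lambda>x. cis (freq k \<bullet> x))"
  unfolding cis_conv_exp by (intro continuous_intros)

text \<open>
  Translation by half a period of the character in a direction with \<open>k\<^sub>i \<noteq> 0\<close> changes its sign but not its
  integral.
\<close>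

lemma torus_integral_character:
  fixes k :: "int ^ 'n"
  assumes "k \<noteq> 0"
  shows "integral torus_cell (\<lambda>x. cis (freq k \<bullet> x)) = 0"
proof -
  from assms obtain i where i: "k $ i \<noteq> 0"
    by (auto simp: vec_eq_iff)
  have step: "cis (freq k \<bullet> (x + s *\<^sub>R axis i 1)) = cis (s * of_int (k $ i)) * cis (freq k \<bullet> x)" for x s i
    by (simp add: inner_add_right inner_axis freq_def cis_mult add.commute)
  have "torus_periodic (\<lambda>x. cis (freq k \<bullet> x))"
    unfolding torus_periodic_def step by simp
  define s where "s = pi / \<bar>of_int (k $ i)\<bar>"
  have "1 \<le> \<bar>of_int (k $ i) :: real\<bar>"
    using i by linarith
  then have s: "0 \<le> s" "s \<le> 2 * pi"
    by (auto simp: s_def field_simps)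
  have "cis (s * of_int (k $ i)) = - 1"
    using i by (cases "k $ i > 0") (auto simp: s_def cis.ctr complex_eq_iff)
  then have "(\<lambda>x. cis (freq k \<bullet> (x + s *\<^sub>R axis i 1))) = (\<lambda>x. - cis (freq k \<bullet> x))"
    by (simp add: step)
  with torus_integral_translate_axis[OF \<open>torus_periodic _\<close> continuous_on_character s, of i]
  show ?thesis
    by simp
qed

definition trig_poly :: "(real ^ 'n \<Rightarrow> complex) \<Rightarrow> bool" where
  "trig_poly q \<longleftrightarrow> (\<exists>K a. finite K \<and> (\<forall>x. q x = (\<Sum>k\<in>K. a k * cis (freq k \<bullet> x))))"

lemma freq_add: "freq (k + l) = freq k + freq l"
  by (simp add: freq_def vec_eq_iff)

lemma freq_minus: "freq (- k) = - freq k"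
  by (simp add: freq_def vec_eq_iff)

lemma freq_0: "freq 0 = 0"
  by (simp add: freq_def vec_eq_iff)

lemma trig_poly_one: "trig_poly (\<lambda>x :: real ^ 'n. 1)"
  unfolding trig_poly_def
  by (intro exI[of _ "{0 :: int ^ 'n}"] exI[of _ "\<lambda>_. 1"]) (simp add: freq_0)

text \<open>
  Products of characters are characters; terms with the same frequency are collected, so that the
  result is indexed by distinct frequencies and its coefficients can be recovered by orthogonality.
\<close>

lemma trig_poly_mult:
  assumes "trig_poly p" "trig_poly q"
  shows "trig_poly (\<lambda>x :: real ^ 'n. p x * q x)"
proof -
  from assms obtain K L a b where K: "finite K" "finite L"
    and p: "\<And>x. p x = (\<Sum>k\<in>K. a k * cis (freq k \<bullet> x))"
    and q: "\<And>x. q x = (\<Sum>k\<in>L. b k * cis (freq k \<bullet> x))"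
    by (auto simp: trig_poly_def)
  let ?g = "\<lambda>z. fst z + snd z"
  have "p x * q x = (\<Sum>m\<in>?g ` (K \<times> L). (\<Sum>z | z \<in> K \<times> L \<and> ?g z = m. a (fst z) * b (snd z)) * cis (freq m \<bullet> x))" for x
  proof -
    have "p x * q x = (\<Sum>z\<in>K \<times> L. a (fst z) * b (snd z) * cis (freq (?g z) \<bullet> x))"
      by (simp add: p q sum_product sum.cartesian_product split_beta freq_add inner_add_left
          cis_mult[symmetric] mult_ac)
    also have "\<dots> = (\<Sum>m\<in>?g ` (K \<times> L). \<Sum>z | z \<in> K \<times> L \<and> ?g z = m. a (fst z) * b (snd z) * cis (freq (?g z) \<bullet> x))"
      using K by (intro sum.image_gen) auto
    also have "\<dots> = (\<Sum>m\<in>?g ` (K \<times> L). (\<Sum>z | z \<in> K \<times> L \<and> ?g z = m. a (fst z) * b (snd z)) * cis (freq m \<bullet> x))"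
      unfolding sum_distrib_right by (intro sum.cong refl) auto
    finally show ?thesis .
  qed
  then show ?thesis
    unfolding trig_poly_def using K by (intro exI conjI allI) auto
qed

lemma trig_poly_prod:
  assumes "\<And>i. i \<in> I \<Longrightarrow> trig_poly (p i)"
  shows "trig_poly (\<lambda>x :: real ^ 'n. \<Prod>i\<in>I. p i x)"
  using assms by (induction I rule: infinite_finite_induct) (auto intro: trig_poly_one trig_poly_mult)

lemma trig_poly_power: "trig_poly p \<Longrightarrow> trig_poly (\<lambda>x :: real ^ 'n. p x ^ N)"
  by (induction N) (auto intro: trig_poly_one trig_poly_mult)

lemma trig_poly_bump: "trig_poly (\<lambda>x :: real ^ 'n. complex_of_real ((1 + cos (x $ i - c)) / 2))"
proof -
  let ?e = "axis i 1 :: int ^ 'n"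
  let ?a = "\<lambda>k. if k = 0 then 1 / 2 else if k = ?e then cis (- c) / 4 else cis c / 4"
  have "freq ?e = axis i 1"
    by (simp add: freq_def vec_eq_iff axis_def)
  then have e: "freq ?e \<bullet> x = x $ i" for x :: "real ^ 'n"
    by (simp add: inner_axis')
  have ne: "?e \<noteq> 0" "- ?e \<noteq> 0" "?e \<noteq> - ?e"
    by (auto simp: vec_eq_iff axis_def)
  have "complex_of_real ((1 + cos (x $ i - c)) / 2) = (\<Sum>k\<in>{0, ?e, - ?e}. ?a k * cis (freq k \<bullet> x))"
    for x :: "real ^ 'n"
    using ne by (simp add: freq_0 freq_minus e cis_mult) (simp add: complex_eq_iff cos_diff sin_diff field_simps)
  then show ?thesis
    unfolding trig_poly_def by (intro exI[of _ "{0, ?e, - ?e}"] exI[of _ ?a]) auto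
qed

lemma fourier_coeff_eq_integral:
  fixes f :: "real ^ 'n \<Rightarrow> real"
  assumes "continuous_on UNIV f"
  shows "fourier_coeff f k =
    integral torus_cell (\<lambda>x. complex_of_real (f x) * cis (- (freq k \<bullet> x))) / (2 * pi) ^ CARD('n)"
proof -
  have "continuous_on (cbox 0 two_pi) (\<lambda>x. complex_of_real (f x) * cis (- (freq k \<bullet> x)))"
    unfolding cis_conv_exp using assms by (intro continuous_intros) (auto intro: continuous_on_subset)
  from absolutely_integrable_continuous[OF this] show ?thesis
    unfolding fourier_coeff_def torus_cell_def
    by (simp add: set_lebesgue_integral_eq_integral(2))
qed

lemma torus_measure: "measure lborel (torus_cell :: (real ^ 'n) set) = (2 * pi) ^ CARD('n)"
  unfolding torus_cell_def by (subst content_cbox_cart) (simp_all add: interval_ne_empty_cart)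

text \<open>
  By orthogonality the coefficients of \<open>p\<close> are \<open>a\<^sub>k = (2\<pi>)\<^sup>-\<^sup>n \<integral> p e\<^sub>-\<^sub>k\<close>, hence \<open>(2\<pi>)\<^sup>n \<bar>a\<^sub>k\<bar> \<le> \<integral> p\<close> for
  nonnegative \<open>p\<close>; and \<open>\<integral> f p = (2\<pi>)\<^sup>n \<Sum> a\<^sub>k c\<^sub>-\<^sub>k\<close>, where \<open>c\<^sub>k\<close> are the Fourier coefficients of \<open>f\<close>.
\<close>

lemma trig_poly_integral_bound:
  fixes f :: "real ^ 'n \<Rightarrow> real"
  assumes f: "continuous_on UNIV f" and q: "trig_poly (\<lambda>x. complex_of_real (p x))"
    and p: "\<And>x. 0 \<le> p x"
    and M: "\<And>K. finite K \<Longrightarrow> (\<Sum>k\<in>K. cmod (fourier_coeff f k)) \<le> M"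
  shows "integral torus_cell (\<lambda>x. f x * p x) \<le> M * integral torus_cell p"
proof -
  from q obtain K a where K: "finite K"
    and eq: "\<And>x. complex_of_real (p x) = (\<Sum>k\<in>K. a k * cis (freq k \<bullet> x))"
    by (auto simp: trig_poly_def)
  have "p = (\<lambda>x. Re (\<Sum>k\<in>K. a k * cis (freq k \<bullet> x)))"
    by (metis eq Re_complex_of_real)
  moreover have "continuous_on A (\<lambda>x. Re (\<Sum>k\<in>K. a k * cis (freq k \<bullet> x)))" for A
    by (intro continuous_intros continuous_on_character)
  ultimately have cp: "continuous_on A p" for A
    by (simp only:)
  have cf: "continuous_on A f" for A
    using f by (rule continuous_on_subset) simp
  have int: "(\<lambda>x. g x) integrable_on torus_cell" if "continuous_on torus_cell g" for g :: "real ^ 'n \<Rightarrow> 'b::banach"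
    using that unfolding torus_cell_def by (rule integrable_continuous)
  define V where "V = (2 * pi) ^ CARD('n)"
  have "V > 0" by (simp add: V_def)
  have coeff: "cmod (a l) * V \<le> integral torus_cell p" if "l \<in> K" for l
  proof -
    have "integral torus_cell (\<lambda>x. complex_of_real (p x) * cis (freq (- l) \<bullet> x))
        = integral torus_cell (\<lambda>x. \<Sum>k\<in>K. a k * cis (freq (k - l) \<bullet> x))"
      unfolding eq sum_distrib_right
      by (simp add: mult.assoc cis_mult inner_add_left[symmetric] freq_add[symmetric])
    also have "\<dots> = (\<Sum>k\<in>K. integral torus_cell (\<lambda>x. a k * cis (freq (k - l) \<bullet> x)))"
      by (intro integral_sum K int continuous_intros continuous_on_character)
    also have "\<dots> = (\<Sum>k\<in>K. if k = l then a l * of_real V else 0)"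
    proof (rule sum.cong)
      fix k
      show "integral torus_cell (\<lambda>x. a k * cis (freq (k - l) \<bullet> x)) = (if k = l then a l * of_real V else 0)"
        using torus_integral_character[of "k - l"] torus_measure[where 'n = 'n]
        by (simp add: freq_0 V_def torus_cell_def scaleR_conv_of_real mult.commute)
    qed simp
    also have "\<dots> = a l * of_real V"
      using K that by simp
    finally have "cmod (a l) * V = cmod (integral torus_cell (\<lambda>x. complex_of_real (p x) * cis (freq (- l) \<bullet> x)))"
      using \<open>V > 0\<close> by (simp add: norm_mult)
    also have "\<dots> \<le> integral torus_cell p"
      using p
      by (intro integral_norm_bound_integral int continuous_intros continuous_on_character cp)
        (auto simp: norm_mult)
    finally show ?thesis .
  qed
  have "complex_of_real (integral torus_cell (\<lambda>x. f x * p x))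
      = integral torus_cell (\<lambda>x. complex_of_real (f x * p x))"
    using integral_linear[OF int[of "\<lambda>x. f x * p x"] bounded_linear_of_real[where 'a = complex]] cf cp
    by (simp add: o_def continuous_on_mult)
  also have "\<dots> = integral torus_cell (\<lambda>x. \<Sum>k\<in>K. a k * (complex_of_real (f x) * cis (- (freq (- k) \<bullet> x))))"
    unfolding of_real_mult eq sum_distrib_left by (simp add: freq_minus mult_ac)
  also have "\<dots> = (\<Sum>k\<in>K. integral torus_cell (\<lambda>x. a k * (complex_of_real (f x) * cis (- (freq (- k) \<bullet> x)))))"
    unfolding cis_conv_exp by (intro integral_sum K int continuous_intros cf)
  also have "\<dots> = (\<Sum>k\<in>K. a k * (of_real V * fourier_coeff f (- k)))"
    using \<open>V > 0\<close> by (simp add: fourier_coeff_eq_integral[OF f] V_def)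
  finally have "\<bar>integral torus_cell (\<lambda>x. f x * p x)\<bar> = cmod (\<Sum>k\<in>K. a k * (of_real V * fourier_coeff f (- k)))"
    by (metis norm_of_real)
  also have "\<dots> \<le> (\<Sum>k\<in>K. (cmod (a k) * V) * cmod (fourier_coeff f (- k)))"
    using \<open>V > 0\<close> by (intro sum_norm_le) (simp add: norm_mult)
  also have "\<dots> \<le> (\<Sum>k\<in>K. integral torus_cell p * cmod (fourier_coeff f (- k)))"
    by (intro sum_mono mult_right_mono coeff) auto
  also have "\<dots> = integral torus_cell p * (\<Sum>k\<in>uminus ` K. cmod (fourier_coeff f k))"
    by (simp add: sum_distrib_left sum.reindex)
  also have "\<dots> \<le> integral torus_cell p * M"
    using K p by (intro mult_left_mono M integral_nonneg int cp) auto
  finally show ?thesis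
    by (simp add: mult.commute)
qed

text \<open>
  Averages of \<open>f\<close> with respect to nonnegative trigonometric polynomials are at most \<open>M\<close>. The
  powers of \<open>p x = \<Prod>\<^sub>i (1 + cos (x\<^sub>i - x0\<^sub>i)) / 2\<close> concentrate at the points where \<open>p = 1\<close>, which are the
  lattice translates of \<open>x0\<close>; so these averages tend to \<open>f x0\<close>. If \<open>f x0 > M + \<eta>\<close>, then \<open>p \<le> \<rho> < 1\<close> on the compact
  set \<open>A\<close> where \<open>f \<le> M + \<eta>\<close>, while \<open>p \<ge> \<sigma> > \<rho>\<close> on a box of positive measure near \<open>x0\<close>, and
  \<open>(\<sigma> / \<rho>)\<^sup>N\<close> would be bounded.
\<close>

lemma le_fourier_sum_bound:
  fixes f :: "real ^ 'n \<Rightarrow> real"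
  assumes f: "continuous_on UNIV f" "torus_periodic f"
    and M: "\<And>K. finite K \<Longrightarrow> (\<Sum>k\<in>K. cmod (fourier_coeff f k)) \<le> M"
  shows "f x0 \<le> M"
proof -
  have cell: "f x0 \<le> M" if x0: "x0 \<in> torus_cell" for x0
  proof (rule ccontr)
    assume "\<not> ?thesis"
    then obtain \<eta> where \<eta>: "0 < \<eta>" "M + \<eta> < f x0"
      by (metis add.commute diff_gt_0_iff_gt field_lbound_gt_zero less_diff_eq not_le)
    define p where "p x = (\<Prod>i\<in>UNIV. (1 + cos (x $ i - x0 $ i)) / 2)" for x :: "real ^ 'n"
    have cos0: "0 \<le> 1 + cos t" for t :: real
      using cos_ge_minus_one[of t] by linarith
    have p: "0 \<le> p x" "p x \<le> 1" for x
      by (auto simp: p_def cos0 intro!: prod_nonneg prod_le_1)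
    have cp: "continuous_on A p" for A
      unfolding p_def by (intro continuous_intros) auto
    have cf: "continuous_on A f" for A
      using f(1) by (rule continuous_on_subset) simp
    have tp: "trig_poly (\<lambda>x. complex_of_real (p x ^ N))" for N
      unfolding p_def of_real_power of_real_prod
      by (intro trig_poly_power trig_poly_prod trig_poly_bump)
    have int: "g integrable_on torus_cell" if "continuous_on torus_cell g" for g :: "real ^ 'n \<Rightarrow> real"
      using that unfolding torus_cell_def by (rule integrable_continuous)
    have compact: "compact (torus_cell :: (real ^ 'n) set)"
      by (simp add: torus_cell_def)
    define A where "A = {x \<in> torus_cell. f x \<le> M + \<eta>}"
    have "compact A"
    proof -
      have "A = torus_cell \<inter> f -` {..M + \<eta>}"
        by (auto simp: A_def)
      then show ?thesis
        by (simp add: compact_Int_closed[OF compact closed_vimage[OF closed_atMost cf]])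
    qed
    have p_less: "p x < 1" if "x \<in> A" for x
    proof (rule ccontr)
      assume "\<not> p x < 1"
      have "cos (x $ i - x0 $ i) = 1" for i
      proof -
        have "p x = (1 + cos (x $ i - x0 $ i)) / 2 * (\<Prod>j\<in>UNIV - {i}. (1 + cos (x $ j - x0 $ j)) / 2)"
          unfolding p_def by (rule prod.remove) auto
        also have "\<dots> \<le> (1 + cos (x $ i - x0 $ i)) / 2 * 1"
          by (intro mult_left_mono prod_le_1) (auto simp: cos0)
        finally have "p x \<le> (1 + cos (x $ i - x0 $ i)) / 2"
          by simp
        moreover have "1 \<le> p x"
          using \<open>\<not> p x < 1\<close> by simp
        ultimately have "1 \<le> cos (x $ i - x0 $ i)"
          by (simp add: field_simps)
        then show ?thesis
          by (intro antisym cos_le_one)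
      qed
      then have "\<forall>i. \<exists>m. x $ i - x0 $ i = of_int m * (2 * pi)"
        by (simp add: cos_one_2pi_int mult.assoc)
      then obtain m where "\<And>i. x $ i - x0 $ i = of_int (m i) * (2 * pi)"
        by metis
      then have "x = x0 + (2 * pi) *\<^sub>R freq (\<chi> i. m i)"
        by (simp add: vec_eq_iff freq_def algebra_simps)
      then have "f x = f x0"
        using torus_periodic_lattice[OF f(2)] by metis
      then show False
        using that \<eta> by (simp add: A_def)
    qed
    obtain \<rho> where \<rho>: "1 / 2 \<le> \<rho>" "\<rho> < 1" "\<And>x. x \<in> A \<Longrightarrow> p x \<le> \<rho>"
    proof (cases "A = {}")
      case True
      then show ?thesis using that[of "1 / 2"] by simp
    next
      case False
      then obtain a where "a \<in> A" "\<And>x. x \<in> A \<Longrightarrow> p x \<le> p a"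
        using continuous_attains_sup[OF \<open>compact A\<close> _ cp] by blast
      then show ?thesis
        using that[of "max (1 / 2) (p a)"] p_less[of a] by force
    qed
    define \<sigma> where "\<sigma> = (1 + \<rho>) / 2"
    have \<sigma>: "\<rho> < \<sigma>" "\<sigma> < 1" "0 < \<sigma>"
      using \<rho> by (auto simp: \<sigma>_def)
    have "open {x. \<sigma> < p x}"
      by (intro open_Collect_less continuous_intros cp)
    moreover have "x0 \<in> {x. \<sigma> < p x}"
      using \<sigma> by (simp add: p_def)
    \<comment> \<open>The point \<open>x0\<close> may lie on the boundary of the cell; the box is then found next to it.\<close>
    moreover have ne: "box 0 (two_pi :: real ^ 'n) \<noteq> {}"
      by (auto simp: box_ne_empty Basis_vec_def inner_axis)
    then have "x0 \<in> closure (box 0 two_pi)"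
      using x0 by (simp add: torus_cell_def)
    ultimately obtain y where y: "y \<in> box 0 two_pi \<inter> {x. \<sigma> < p x}"
      using open_Int_closure_eq_empty[of "{x. \<sigma> < p x}" "box 0 two_pi"] by blast
    moreover have "open (box 0 two_pi \<inter> {x. \<sigma> < p x})"
      using \<open>open {x. \<sigma> < p x}\<close> by blast
    ultimately obtain e where e: "e > 0" "ball y e \<subseteq> box 0 two_pi \<inter> {x. \<sigma> < p x}"
      using open_contains_ball by blast
    obtain a b where ab: "y \<in> box a b" "box a b \<subseteq> ball y e"
      using rational_boxes[OF e(1), of y] by blast
    have "cbox a b = closure (box a b)"
      using ab(1) by (subst closure_box) auto
    also have "\<dots> \<subseteq> torus_cell \<inter> {x. \<sigma> \<le> p x}"
    proof (rule closure_minimal)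
      show "closed (torus_cell \<inter> {x. \<sigma> \<le> p x})"
        by (intro closed_Int compact_imp_closed[OF compact] closed_Collect_le continuous_intros cp)
      show "box a b \<subseteq> torus_cell \<inter> {x. \<sigma> \<le> p x}"
        using ab(2) e(2) box_subset_cbox[of 0 two_pi] unfolding torus_cell_def by force
    qed
    finally have sub: "cbox a b \<subseteq> torus_cell" and big: "\<And>x. x \<in> cbox a b \<Longrightarrow> \<sigma> \<le> p x"
      by auto
    define W where "W = measure lborel (cbox a b)"
    define V where "V = measure lborel (torus_cell :: (real ^ 'n) set)"
    have "W > 0"
      using ab(1) by (auto simp: W_def content_pos_lt_eq mem_box intro: less_trans)
    have low: "\<sigma> ^ N * W \<le> integral torus_cell (\<lambda>x. p x ^ N)" for N
    proof -
      have "\<sigma> ^ N * W = integral (cbox a b) (\<lambda>x. \<sigma> ^ N)"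
        by (simp add: W_def)
      also have "\<dots> \<le> integral (cbox a b) (\<lambda>x. p x ^ N)"
        using big \<sigma> by (intro integral_le integrable_continuous continuous_intros cp) (auto intro!: power_mono)
      also have "\<dots> \<le> integral torus_cell (\<lambda>x. p x ^ N)"
        using p sub by (intro integral_subset_le int integrable_continuous continuous_intros cp) auto
      finally show ?thesis .
    qed
    obtain C where C: "0 \<le> C" "\<And>x. x \<in> torus_cell \<Longrightarrow> M - f x \<le> C"
    proof -
      have "compact ((\<lambda>x. M - f x) ` torus_cell)"
        by (intro compact_continuous_image compact continuous_intros cf)
      then obtain C where "\<And>x. x \<in> torus_cell \<Longrightarrow> M - f x \<le> C"
        using compact_imp_bounded[THEN bounded_imp_bdd_above] by (force simp: bdd_above_def)
      then show thesis
        using that[of "max 0 C"] by force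
    qed
    have "\<eta> * (\<sigma> ^ N * W) \<le> (C + \<eta>) * \<rho> ^ N * V" for N
    proof -
      have "\<eta> * p x ^ N \<le> (f x * p x ^ N - M * p x ^ N) + (C + \<eta>) * \<rho> ^ N" if "x \<in> torus_cell" for x
      proof (cases "x \<in> A")
        case True
        have "(\<eta> + (M - f x)) * p x ^ N \<le> (\<eta> + C) * p x ^ N"
          using C(2)[OF that] p by (intro mult_right_mono) auto
        also have "\<dots> \<le> (\<eta> + C) * \<rho> ^ N"
          using \<rho>(3)[OF True] C(1) \<eta>(1) p by (intro mult_left_mono power_mono) auto
        finally show ?thesis by (simp add: algebra_simps)
      next
        case False
        then have "\<eta> * p x ^ N \<le> (f x - M) * p x ^ N"
          using that p by (intro mult_right_mono) (auto simp: A_def)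
        moreover have "0 \<le> (C + \<eta>) * \<rho> ^ N"
          using C(1) \<eta>(1) \<rho>(1) by simp
        ultimately show ?thesis by (simp add: algebra_simps)
      qed
      then have "integral torus_cell (\<lambda>x. \<eta> * p x ^ N)
          \<le> integral torus_cell (\<lambda>x. (f x * p x ^ N - M * p x ^ N) + (C + \<eta>) * \<rho> ^ N)"
        by (intro integral_le int continuous_intros cf cp)
      also have "\<dots> = integral torus_cell (\<lambda>x. f x * p x ^ N) - M * integral torus_cell (\<lambda>x. p x ^ N)
          + (C + \<eta>) * \<rho> ^ N * V"
      proof -
        have "integral torus_cell (\<lambda>x :: real ^ 'n. (C + \<eta>) * \<rho> ^ N) = (C + \<eta>) * \<rho> ^ N * V"
          by (simp add: V_def torus_cell_def)
        then show ?thesis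
          by (subst integral_add integral_diff; (intro int continuous_intros cf cp)?)+ simp
      qed
      also have "integral torus_cell (\<lambda>x. f x * p x ^ N) \<le> M * integral torus_cell (\<lambda>x. p x ^ N)"
        using p by (intro trig_poly_integral_bound[OF f(1) tp] M) auto
      finally have "\<eta> * integral torus_cell (\<lambda>x. p x ^ N) \<le> (C + \<eta>) * \<rho> ^ N * V"
        by simp
      moreover have "\<eta> * (\<sigma> ^ N * W) \<le> \<eta> * integral torus_cell (\<lambda>x. p x ^ N)"
        using \<eta>(1) low by (intro mult_left_mono) auto
      ultimately show ?thesis by linarith
    qed
    then have "(\<sigma> / \<rho>) ^ N \<le> (C + \<eta>) * V / (\<eta> * W)" for N
      using \<eta>(1) \<open>W > 0\<close> \<rho>(1) by (simp add: field_simps power_divide)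
    moreover obtain N where "(C + \<eta>) * V / (\<eta> * W) < (\<sigma> / \<rho>) ^ N"
      using real_arch_pow[of "\<sigma> / \<rho>"] \<sigma> \<rho> by auto
    ultimately show False
      by (meson not_le)
  qed
  obtain k where "x0 + (2 * pi) *\<^sub>R freq k \<in> torus_cell"
    using torus_cell_representative .
  then show ?thesis
    using cell torus_periodic_lattice[OF f(2), of x0 k] by metis
qed

lemma abs_le_fourier_sum_bound:
  fixes f :: "real ^ 'n \<Rightarrow> real"
  assumes f: "continuous_on UNIV f" "torus_periodic f"
    and M: "\<And>K. finite K \<Longrightarrow> (\<Sum>k\<in>K. cmod (fourier_coeff f k)) \<le> M"
  shows "\<bar>f x\<bar> \<le> M"
proof -
  have "fourier_coeff (\<lambda>x. - f x) k = - fourier_coeff f k" for k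
    using f(1) by (simp add: fourier_coeff_eq_integral continuous_on_minus)
  then have "- f x \<le> M"
    using f M
    by (intro le_fourier_sum_bound[of "\<lambda>x. - f x"]) (auto simp: torus_periodic_def intro: continuous_on_minus)
  moreover have "f x \<le> M"
    using le_fourier_sum_bound[OF f M] .
  ultimately show ?thesis by simp
qed

section \<open>Sobolev embedding\<close>

lemma bounded_sum_over_int:
  fixes t :: real
  assumes "t > 1 / 2"
  obtains C where "0 \<le> C" "\<And>m :: nat. (\<Sum>j\<in>{- int m..int m}. (1 + (of_int j)\<^sup>2) powr (- t)) \<le> C"
proof -
  define g where "g x = (1 + x\<^sup>2) powr (- t)" for x :: real
  have "summable (\<lambda>n. real n powr (- 2 * t))"
    using assms by (simp add: summable_real_powr_iff)
  then have sg: "summable (\<lambda>n. g (real n))"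
  proof (rule summable_comparison_test_ev[rotated])
    show "\<forall>\<^sub>F n in sequentially. norm (g (real n)) \<le> real n powr (- 2 * t)"
      using eventually_gt_at_top[of 0]
    proof eventually_elim
      case (elim n)
      have "g (real n) \<le> ((real n)\<^sup>2) powr (- t)"
        unfolding g_def using elim assms by (intro powr_mono2') auto
      also have "\<dots> = (real n powr 2) powr (- t)"
        using elim by (simp add: powr_numeral)
      also have "\<dots> = real n powr (- 2 * t)"
        by (subst powr_powr) simp
      finally show ?case by (simp add: g_def)
    qed
  qed
  have "(\<Sum>j\<in>{- int m..int m}. g (of_int j)) \<le> 2 * (\<Sum>n. g (real n))" for m
  proof -
    have "{- int m..int m} \<subseteq> int ` {..m} \<union> (\<lambda>n. - int n) ` {..m}"
    proof
      fix j assume "j \<in> {- int m..int m}"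
      then have "j = int (nat j) \<and> nat j \<le> m \<or> j = - int (nat (- j)) \<and> nat (- j) \<le> m"
        by auto
      then show "j \<in> int ` {..m} \<union> (\<lambda>n. - int n) ` {..m}"
        by blast
    qed
    then have "(\<Sum>j\<in>{- int m..int m}. g (of_int j)) \<le> (\<Sum>j\<in>int ` {..m} \<union> (\<lambda>n. - int n) ` {..m}. g (of_int j))"
      by (intro sum_mono2) (auto simp: g_def)
    also have "\<dots> \<le> (\<Sum>j\<in>int ` {..m}. g (of_int j)) + (\<Sum>j\<in>(\<lambda>n. - int n) ` {..m}. g (of_int j))"
      by (subst sum_Un) (auto intro!: sum_nonneg simp: g_def)
    also have "\<dots> = 2 * (\<Sum>n\<le>m. g (real n))"
      by (simp add: sum.reindex inj_on_def g_def)
    also have "(\<Sum>n\<le>m. g (real n)) \<le> (\<Sum>n. g (real n))"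
      by (intro sum_le_suminf sg) (auto simp: g_def)
    finally show ?thesis by simp
  qed
  moreover have "0 \<le> 2 * (\<Sum>n. g (real n))"
    by (simp add: g_def suminf_nonneg[OF sg[unfolded g_def]])
  ultimately show thesis
    using that[of "2 * (\<Sum>n. g (real n))"] by (simp add: g_def)
qed

text \<open>
  Each factor on the right of \<open>(1 + \<bar>k\<bar>\<^sup>2)\<^sup>n \<ge> \<Prod>\<^sub>i (1 + k\<^sub>i\<^sup>2)\<close> is a function of one coordinate, so the lattice sum is at most
  the \<open>n\<close>-th power of a one-dimensional sum with exponent \<open>t = s / n > 1/2\<close>.
\<close>

lemma bounded_sum_over_lattice:
  fixes s :: real
  assumes s: "s > CARD('n) / 2"
  obtains C where "0 \<le> C"
    "\<And>K :: (int ^ 'n) set. finite K \<Longrightarrow> (\<Sum>k\<in>K. (1 + (norm (freq k))\<^sup>2) powr (- s)) \<le> C"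
proof -
  define t where "t = s / CARD('n)"
  have "t > 1 / 2"
    using s by (simp add: t_def field_simps)
  then obtain C where C: "0 \<le> C" "\<And>m :: nat. (\<Sum>j\<in>{- int m..int m}. (1 + (of_int j)\<^sup>2) powr (- t)) \<le> C"
    using bounded_sum_over_int by blast
  define g where "g j = (1 + (of_int j)\<^sup>2) powr (- t)" for j :: int
  have "(\<Sum>k\<in>K. (1 + (norm (freq k))\<^sup>2) powr (- s)) \<le> C ^ CARD('n)" if K: "finite K" for K :: "(int ^ 'n) set"
  proof -
    define m where "m = (\<Sum>k\<in>K. \<Sum>i\<in>UNIV. nat \<bar>k $ i\<bar>)"
    let ?J = "{- int m..int m}"
    have inJ: "k $ i \<in> ?J" if "k \<in> K" for k i
    proof -
      have "nat \<bar>k $ i\<bar> \<le> (\<Sum>i\<in>UNIV. nat \<bar>k $ i\<bar>)"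
        by (rule member_le_sum) auto
      also have "\<dots> \<le> m"
        unfolding m_def by (rule member_le_sum[OF that _ K]) auto
      finally show ?thesis by auto
    qed
    have "(1 + (norm (freq k))\<^sup>2) powr (- s) \<le> (\<Prod>i\<in>UNIV. g (k $ i))" for k :: "int ^ 'n"
    proof -
      have "(1 + (norm (freq k))\<^sup>2) powr (- s) = (1 + (norm (freq k))\<^sup>2) powr (\<Sum>i\<in>(UNIV :: 'n set). - t)"
        by (simp add: t_def)
      also have "\<dots> = (\<Prod>i\<in>(UNIV :: 'n set). (1 + (norm (freq k))\<^sup>2) powr (- t))"
        by (rule powr_sum) (auto simp: add_nonneg_eq_0_iff)
      also have "\<dots> \<le> (\<Prod>i\<in>UNIV. g (k $ i))"
      proof (rule prod_mono)
        fix i :: 'n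
        have "(of_int (k $ i))\<^sup>2 \<le> (norm (freq k))\<^sup>2"
          using component_le_norm_cart[of "freq k" i] by (simp add: freq_def abs_le_square_iff[symmetric])
        then have "(1 + (norm (freq k))\<^sup>2) powr (- t) \<le> g (k $ i)"
          unfolding g_def using \<open>t > 1 / 2\<close> by (intro powr_mono2') (auto intro: add_pos_nonneg)
        then show "0 \<le> (1 + (norm (freq k))\<^sup>2) powr (- t) \<and> (1 + (norm (freq k))\<^sup>2) powr (- t) \<le> g (k $ i)"
          by simp
      qed
      finally show ?thesis .
    qed
    then have "(\<Sum>k\<in>K. (1 + (norm (freq k))\<^sup>2) powr (- s)) \<le> (\<Sum>k\<in>K. \<Prod>i\<in>UNIV. g (k $ i))"
      by (intro sum_mono)
    also have "\<dots> = (\<Sum>\<kappa>\<in>vec_nth ` K. \<Prod>i\<in>UNIV. g (\<kappa> i))"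
      by (subst sum.reindex) (auto simp: inj_on_def vec_nth_inject)
    also have "\<dots> \<le> (\<Sum>\<kappa>\<in>PiE (UNIV :: 'n set) (\<lambda>_. ?J). \<Prod>i\<in>UNIV. g (\<kappa> i))"
    proof (rule sum_mono2)
      show "vec_nth ` K \<subseteq> PiE UNIV (\<lambda>_. ?J)"
        using inJ by auto
    qed (auto simp: g_def intro!: finite_PiE prod_nonneg)
    also have "\<dots> = (\<Prod>i\<in>(UNIV :: 'n set). \<Sum>j\<in>?J. g j)"
      by (rule prod_sum_PiE[symmetric]) auto
    also have "\<dots> \<le> C ^ CARD('n)"
      using C(2)[of m] by (simp add: g_def power_mono sum_nonneg)
    finally show ?thesis .
  qed
  then show thesis
    using C(1) by (intro that[of "C ^ CARD('n)"]) auto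
qed

text \<open>
  The supremum is at most the sum of the moduli of the Fourier coefficients, which the Cauchy-Schwarz
  inequality estimates by the Sobolev norm once \<open>\<Sum>\<^sub>k (1 + \<bar>k\<bar>\<^sup>2)\<^sup>-\<^sup>s\<close> converges.
\<close>

lemma sobolev_embedding:
  fixes s :: real
  assumes s: "s > CARD('n) / 2"
  obtains C where "0 \<le> C"
    "\<And>(f :: real ^ 'n \<Rightarrow> real) x. continuous_on UNIV f \<Longrightarrow> torus_periodic f \<Longrightarrow>
       sobolev_term s f summable_on UNIV \<Longrightarrow> \<bar>f x\<bar> \<le> C * sobolev_norm s f"
proof -
  obtain C where C: "0 \<le> C"
    "\<And>K :: (int ^ 'n) set. finite K \<Longrightarrow> (\<Sum>k\<in>K. (1 + (norm (freq k))\<^sup>2) powr (- s)) \<le> C"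
    using bounded_sum_over_lattice[OF s] by blast
  have "\<bar>f x\<bar> \<le> sqrt C * sobolev_norm s f"
    if f: "continuous_on UNIV f" "torus_periodic f" and sum: "sobolev_term s f summable_on UNIV"
    for f :: "real ^ 'n \<Rightarrow> real" and x
  proof (rule abs_le_fourier_sum_bound[OF f])
    fix K :: "(int ^ 'n) set" assume K: "finite K"
    define w where "w k = 1 + (norm (freq k))\<^sup>2" for k :: "int ^ 'n"
    have w: "w k > 0" for k
      by (simp add: w_def add_pos_nonneg)
    have nonneg: "0 \<le> sobolev_term s f k" for k
      by (simp add: sobolev_term_def)
    have "(\<Sum>k\<in>K. cmod (fourier_coeff f k))
        = (\<Sum>k\<in>K. w k powr (- s / 2) * (w k powr (s / 2) * cmod (fourier_coeff f k)))"
      using w by (intro sum.cong) (auto simp: mult.assoc[symmetric] powr_add[symmetric] less_imp_neq[symmetric])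
    then have "(\<Sum>k\<in>K. cmod (fourier_coeff f k))\<^sup>2
        \<le> (\<Sum>k\<in>K. (w k powr (- s / 2))\<^sup>2) * (\<Sum>k\<in>K. (w k powr (s / 2) * cmod (fourier_coeff f k))\<^sup>2)"
      by (simp only: Cauchy_Schwarz_ineq_sum)
    also have "(\<Sum>k\<in>K. (w k powr (- s / 2))\<^sup>2) = (\<Sum>k\<in>K. w k powr (- s))"
      by (simp add: power2_eq_square powr_add[symmetric])
    also have "(\<Sum>k\<in>K. (w k powr (s / 2) * cmod (fourier_coeff f k))\<^sup>2) = (\<Sum>k\<in>K. sobolev_term s f k)"
      by (simp add: sobolev_term_def w_def power_mult_distrib)
        (simp add: power2_eq_square powr_add[symmetric])
    also have "(\<Sum>k\<in>K. w k powr (- s)) * (\<Sum>k\<in>K. sobolev_term s f k) \<le> C * (\<Sum>\<^sub>\<infinity>k. sobolev_term s f k)"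
      using C K by (intro mult_mono finite_sum_le_infsum sum sum_nonneg) (auto simp: w_def nonneg)
    finally show "(\<Sum>k\<in>K. cmod (fourier_coeff f k)) \<le> sqrt C * sobolev_norm s f"
      unfolding sobolev_norm_def real_sqrt_mult[symmetric] by (rule real_le_rsqrt)
  qed
  then show thesis
    using C(1) by (intro that[of "sqrt C"]) auto
qed

text \<open>
  The Sobolev norm is an infinite sum, with value 0 when that sum diverges; the estimate by the norm is
  meaningful for a difference only after summability has been checked.
\<close>

lemma sobolev_term_diff_summable:
  fixes f g :: "real ^ 'n \<Rightarrow> real"
  assumes "continuous_on UNIV f" "continuous_on UNIV g"
    and "sobolev_term s f summable_on UNIV" "sobolev_term s g summable_on UNIV"
  shows "sobolev_term s (\<lambda>x. f x - g x) summable_on UNIV"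
proof (rule summable_on_comparison_test)
  show "(\<lambda>k. 2 * sobolev_term s f k + 2 * sobolev_term s g k) summable_on UNIV"
    using assms by (intro summable_on_add summable_on_cmult_right)
  fix k
  have int: "(\<lambda>x. complex_of_real (u x) * cis (- (freq k \<bullet> x))) integrable_on torus_cell"
    if "continuous_on UNIV u" for u :: "real ^ 'n \<Rightarrow> real"
    unfolding torus_cell_def cis_conv_exp using that
    by (intro integrable_continuous continuous_intros) (auto intro: continuous_on_subset)
  have "fourier_coeff (\<lambda>x. f x - g x) k = fourier_coeff f k - fourier_coeff g k"
    using assms int[of f] int[of g]
    by (simp add: fourier_coeff_eq_integral continuous_on_diff left_diff_distrib integral_diff diff_divide_distrib)
  moreover have "(cmod (a - b))\<^sup>2 \<le> 2 * (cmod a)\<^sup>2 + 2 * (cmod b)\<^sup>2" for a b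
  proof -
    have "(cmod (a - b))\<^sup>2 \<le> (cmod a + cmod b)\<^sup>2"
      by (intro power_mono norm_triangle_ineq4) auto
    also have "\<dots> \<le> (cmod a + cmod b)\<^sup>2 + (cmod a - cmod b)\<^sup>2"
      by simp
    also have "\<dots> = 2 * (cmod a)\<^sup>2 + 2 * (cmod b)\<^sup>2"
      by (simp add: power2_eq_square algebra_simps)
    finally show ?thesis .
  qed
  ultimately have "(cmod (fourier_coeff (\<lambda>x. f x - g x) k))\<^sup>2
      \<le> 2 * (cmod (fourier_coeff f k))\<^sup>2 + 2 * (cmod (fourier_coeff g k))\<^sup>2"
    by simp
  from mult_left_mono[OF this, of "(1 + (norm (freq k))\<^sup>2) powr s"]
  show "sobolev_term s (\<lambda>x. f x - g x) k \<le> 2 * sobolev_term s f k + 2 * sobolev_term s g k"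
    by (simp add: sobolev_term_def algebra_simps)
  show "0 \<le> sobolev_term s (\<lambda>x. f x - g x) k"
    by (simp add: sobolev_term_def)
qed

text \<open>
  Smoothness in \<open>(t, x)\<close> controls the solutions for \<open>t > 0\<close> only. At \<open>t = 0\<close> their uniform continuity in time
  has to be read off from the Sobolev norm, by applying the embedding to differences.
\<close>

lemma C0_sobolev_uniform:
  fixes u :: "real \<Rightarrow> real ^ 'n \<Rightarrow> real"
  assumes s: "s > CARD('n) / 2" and u: "C0_sobolev s I u" and t: "t \<in> I"
    and cont: "\<And>t. t \<in> I \<Longrightarrow> continuous_on UNIV (u t)" and \<epsilon>: "\<epsilon> > 0"
  shows "\<forall>\<^sub>F \<tau> in at t within I. \<forall>x. \<bar>u \<tau> x - u t x\<bar> < \<epsilon>"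
proof -
  obtain C where C: "0 \<le> C"
    "\<And>(f :: real ^ 'n \<Rightarrow> real) x. continuous_on UNIV f \<Longrightarrow> torus_periodic f \<Longrightarrow>
       sobolev_term s f summable_on UNIV \<Longrightarrow> \<bar>f x\<bar> \<le> C * sobolev_norm s f"
    using sobolev_embedding[OF s] by blast
  have sob: "torus_periodic (u \<tau>)" "sobolev_term s (u \<tau>) summable_on UNIV" if "\<tau> \<in> I" for \<tau>
    using u that by (auto simp: C0_sobolev_def in_sobolev_def)
  have bound: "\<bar>u \<tau> x - u t x\<bar> \<le> C * sobolev_norm s (\<lambda>x. u \<tau> x - u t x)" if "\<tau> \<in> I" for \<tau> x
    using that t sob
    by (intro C(2) continuous_on_diff cont sobolev_term_diff_summable) (auto simp: torus_periodic_def)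
  have "((\<lambda>\<tau>. C * sobolev_norm s (\<lambda>x. u \<tau> x - u t x)) \<longlongrightarrow> C * 0) (at t within I)"
    using u t by (intro tendsto_mult_left) (auto simp: C0_sobolev_def)
  then have "\<forall>\<^sub>F \<tau> in at t within I. C * sobolev_norm s (\<lambda>x. u \<tau> x - u t x) < \<epsilon>"
    using \<epsilon> by (intro order_tendstoD) auto
  moreover have "\<forall>\<^sub>F \<tau> in at t within I. \<tau> \<in> I"
    by (simp add: eventually_at_topological) blast
  ultimately show ?thesis
  proof eventually_elim
    case (elim \<tau>)
    then show ?case
      using bound[of \<tau>] le_less_trans by blast
  qed
qed

section \<open>Comparison of solutions\<close>

theorem proposition2p4:
  fixes h\<^sub>1 h\<^sub>2 :: "real \<Rightarrow> real ^ 'n \<Rightarrow> real" and T :: real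
  assumes "0 < T"
    and "regular_solution T h\<^sub>1"
    and "regular_solution T h\<^sub>2"
    and "\<forall>x. h\<^sub>1 0 x \<le> h\<^sub>2 0 x"
  shows "\<forall>t\<in>{0..T}. \<forall>x. h\<^sub>1 t x \<le> h\<^sub>2 t x"
proof -
  have dn: "\<exists>h\<^sub>t g. (\<forall>x. ((\<lambda>\<tau>. h \<tau> x) has_real_derivative h\<^sub>t x) (at t within {0..T})) \<and>
      has_dirichlet_neumann (h t) (h t) g \<and> (\<forall>x. h\<^sub>t x + g x = 0)"
    if "regular_solution T h" "t \<in> {0..T}" for h :: "real \<Rightarrow> real ^ 'n \<Rightarrow> real" and t
    using that by (auto simp: regular_solution_def hele_shaw_solution_def)
  have contx: "continuous_on UNIV (h t)"
    if "regular_solution T h" "t \<in> {0..T}" for h :: "real \<Rightarrow> real ^ 'n \<Rightarrow> real" and t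
    using dn[OF that] has_dirichlet_neumann_continuous by blast
  have per: "torus_periodic (h t)"
    if "regular_solution T h" "t \<in> {0..T}" for h :: "real \<Rightarrow> real ^ 'n \<Rightarrow> real" and t
    using that by (auto simp: regular_solution_def C0_sobolev_def in_sobolev_def)
  have joint: "continuous_on ({0<..T} \<times> UNIV) (\<lambda>(t, x). h t x)"
    if "regular_solution T h" for h :: "real \<Rightarrow> real ^ 'n \<Rightarrow> real"
    using that unfolding regular_solution_def C_infinity_on_def by (metis Ck_on.simps(1))
  have initial: "\<forall>\<^sub>F \<tau> in at 0 within {0..T}. \<forall>x. \<bar>h \<tau> x - h 0 x\<bar> < \<epsilon>"
    if h: "regular_solution T h" and "\<epsilon> > 0" for h :: "real \<Rightarrow> real ^ 'n \<Rightarrow> real" and \<epsilon>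
  proof -
    from h obtain s where "s > CARD('n) / 2 + 1" "C0_sobolev s {0..T} h"
      by (auto simp: regular_solution_def)
    then show ?thesis
      using \<open>0 < T\<close> \<open>\<epsilon> > 0\<close> by (intro C0_sobolev_uniform[of s] contx[OF h]) auto
  qed
  have strict: "h\<^sub>1 t x < h\<^sub>2 t x + \<epsilon> * (1 + t)" if \<epsilon>: "\<epsilon> > 0" and t: "t \<in> {0..T}" for \<epsilon> t x
  proof (rule ccontr)
    assume contra: "\<not> ?thesis"
    define d where "d t x = h\<^sub>1 t x - (h\<^sub>2 t x + \<epsilon> * (1 + t))" for t x
    \<comment> \<open>Near \<open>t = 0\<close> strictness comes from the Sobolev continuity, since both solutions are within \<open>\<epsilon> / 2\<close> of
      their initial values.\<close>
    have "\<epsilon> / 2 > 0" using \<epsilon> by simp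
    note close = initial[OF assms(2) this] initial[OF assms(3) this]
    have "\<forall>\<^sub>F \<tau> in at 0 within {0..T}. \<tau> \<in> {0..T}"
      by (simp add: eventually_at_filter)
    with close have "\<forall>\<^sub>F \<tau> in at 0 within {0..T}. \<forall>x. d \<tau> x < 0"
    proof eventually_elim
      case (elim \<tau>)
      show ?case
      proof
        fix x
        have "0 \<le> \<epsilon> * \<tau>"
          using elim \<epsilon> by auto
        moreover have "\<bar>h\<^sub>1 \<tau> x - h\<^sub>1 0 x\<bar> < \<epsilon> / 2" "\<bar>h\<^sub>2 \<tau> x - h\<^sub>2 0 x\<bar> < \<epsilon> / 2" "h\<^sub>1 0 x \<le> h\<^sub>2 0 x"
          using elim assms(4) by blast+
        ultimately show "d \<tau> x < 0"
          unfolding d_def distrib_left by linarith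
      qed
    qed
    then obtain \<delta> where \<delta>: "0 < \<delta>" "\<And>\<tau> x. \<tau> \<in> {0..T} \<Longrightarrow> \<tau> \<noteq> 0 \<Longrightarrow> \<tau> < \<delta> \<Longrightarrow> d \<tau> x < 0"
      by (auto simp: eventually_at)
    have d0: "d 0 x < 0" for x
      using assms(4)[rule_format, of x] \<epsilon> by (simp add: d_def)
    have early: "d \<tau> x < 0" if "\<tau> \<in> {0..T}" "\<tau> < \<delta>" for \<tau> x
      using that \<delta>(2) d0 by (cases "\<tau> = 0") auto
    have dper: "torus_periodic (d \<tau>)" if "\<tau> \<in> {0..T}" for \<tau>
      using per[OF assms(2) that] per[OF assms(3) that] by (simp add: d_def torus_periodic_def)
    have cell: "\<exists>y\<in>torus_cell. d \<tau> y = d \<tau> x" if "\<tau> \<in> {0..T}" for \<tau> x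
      using torus_cell_representative[of x] torus_periodic_lattice[OF dper[OF that]] by metis
    \<comment> \<open>By periodicity the contact set may be taken in the cell; bounded away from \<open>t = 0\<close> it is compact, so
      there is a first contact time \<open>t0\<close>. The minimum with \<open>T\<close> keeps the time interval in \<open>(0, T]\<close>.\<close>
    define S where "S = {z \<in> {min \<delta> T..T} \<times> torus_cell. 0 \<le> d (fst z) (snd z)}"
    have cd: "continuous_on ({0<..T} \<times> UNIV) (\<lambda>z. d (fst z) (snd z))"
      using joint[OF assms(2)] joint[OF assms(3)] unfolding d_def split_beta
      by (intro continuous_intros) auto
    have "compact ({min \<delta> T..T} \<times> (torus_cell :: (real ^ 'n) set))"
      by (intro compact_Times) (auto simp: torus_cell_def)
    moreover have "closed S"
    proof -
      have "continuous_on ({min \<delta> T..T} \<times> torus_cell) (\<lambda>z. d (fst z) (snd z))"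
        using \<delta>(1) \<open>0 < T\<close> by (intro continuous_on_subset[OF cd]) auto
      from continuous_closed_preimage[OF this compact_imp_closed[OF calculation], of "{0..}"]
      show ?thesis
        by (simp add: S_def vimage_def Int_def)
    qed
    moreover have "S = ({min \<delta> T..T} \<times> torus_cell) \<inter> S"
      by (auto simp: S_def)
    ultimately have "compact S"
      by (metis compact_Int_closed)
    have late: "\<delta> \<le> \<tau>" if "\<tau> \<in> {0..T}" "0 \<le> d \<tau> x" for \<tau> x
      using early[of \<tau> x] that by fastforce
    have inS: "\<exists>y. (\<tau>, y) \<in> S" if "\<tau> \<in> {0..T}" "0 \<le> d \<tau> x" for \<tau> x
      using cell[OF that(1), of x] late[OF that] that by (auto simp: S_def)
    have "S \<noteq> {}"
      using inS[OF t, of x] contra by (auto simp: d_def)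
    obtain p where p: "p \<in> S" "\<And>q. q \<in> S \<Longrightarrow> fst p \<le> fst q"
      using continuous_attains_inf[OF \<open>compact S\<close> \<open>S \<noteq> {}\<close> continuous_on_fst[OF continuous_on_id]] by auto
    obtain t0 x0 where p_eq: "p = (t0, x0)" by fastforce
    have t0: "0 < t0" "t0 \<in> {0..T}" and contact: "0 \<le> d t0 x0"
      using p(1) \<delta>(1) \<open>0 < T\<close> by (auto simp: S_def p_eq)
    have before: "d \<tau> x < 0" if "\<tau> \<in> {0..T}" "\<tau> < t0" for \<tau> x
      using inS[OF that(1), of x] p(2) that(2) by (force simp: p_eq)
    obtain h\<^sub>1' g\<^sub>1 where 1: "\<And>x. ((\<lambda>\<tau>. h\<^sub>1 \<tau> x) has_real_derivative h\<^sub>1' x) (at t0 within {0..T})"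
      "has_dirichlet_neumann (h\<^sub>1 t0) (h\<^sub>1 t0) g\<^sub>1" "\<And>x. h\<^sub>1' x + g\<^sub>1 x = 0"
      using dn[OF assms(2) t0(2)] by blast
    obtain h\<^sub>2' g\<^sub>2 where 2: "\<And>x. ((\<lambda>\<tau>. h\<^sub>2 \<tau> x) has_real_derivative h\<^sub>2' x) (at t0 within {0..T})"
      "has_dirichlet_neumann (h\<^sub>2 t0) (h\<^sub>2 t0) g\<^sub>2" "\<And>x. h\<^sub>2' x + g\<^sub>2 x = 0"
      using dn[OF assms(3) t0(2)] by blast
    have dd: "((\<lambda>\<tau>. d \<tau> x) has_real_derivative h\<^sub>1' x - (h\<^sub>2' x + \<epsilon>)) (at t0 within {0..T})" for x
      unfolding d_def by (auto intro!: derivative_eq_intros 1(1) 2(1))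
    have d_le: "d t0 x \<le> 0" for x
    proof (rule tendsto_upperbound)
      have "((\<lambda>\<tau>. d \<tau> x) \<longlongrightarrow> d t0 x) (at t0 within {0..T})"
        using DERIV_continuous[OF dd[of x]] by (simp add: continuous_within)
      then show "((\<lambda>\<tau>. d \<tau> x) \<longlongrightarrow> d t0 x) (at t0 within {0..t0})"
        by (rule tendsto_within_subset) (use t0(2) in auto)
      have "d \<tau> x \<le> 0" if "\<tau> \<in> {0..t0}" "\<tau> \<noteq> t0" for \<tau>
        using before[of \<tau> x] that t0(2) by simp
      then show "\<forall>\<^sub>F \<tau> in at t0 within {0..t0}. d \<tau> x \<le> 0"
        by (simp add: eventually_at_filter)
      show "at t0 within {0..t0} \<noteq> bot"
        using t0(1) by (simp add: at_within_Icc_at_left)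
    qed
    then have eq: "d t0 x0 = 0"
      using contact by (simp add: order_antisym)
    have "g\<^sub>2 x0 \<le> g\<^sub>1 x0"
      using d_le eq t0(2)
      by (intro dirichlet_neumann_contact[OF 1(2) 2(2) per[OF assms(2)] per[OF assms(3)], where c = "\<epsilon> * (1 + t0)"])
        (auto simp: d_def algebra_simps)
    \<comment> \<open>The contact lemma and the equation give \<open>\<partial>\<^sub>t h\<^sub>1 \<le> \<partial>\<^sub>t h\<^sub>2\<close> at the contact point, so \<open>d\<close> was positive
      just before \<open>t0\<close>, against the choice of \<open>t0\<close>.\<close>
    then have "h\<^sub>1' x0 - (h\<^sub>2' x0 + \<epsilon>) < 0"
      using 1(3)[of x0] 2(3)[of x0] \<epsilon> by linarith
    then obtain r where r: "r > 0" "\<And>k. 0 < k \<Longrightarrow> t0 - k \<in> {0..T} \<Longrightarrow> k < r \<Longrightarrow> d t0 x0 < d (t0 - k) x0"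
      using has_real_derivative_neg_dec_left[OF dd] by blast
    define k where "k = min r t0 / 2"
    have "0 < k" "k < r" "k < t0"
      using r(1) t0(1) by (auto simp: k_def)
    then show False
      using r(2)[of k] before[of "t0 - k" x0] eq t0(2) by simp
  qed
  show ?thesis
  proof (intro ballI allI)
    fix t x assume t: "t \<in> {0..T}"
    have "h\<^sub>1 t x \<le> h\<^sub>2 t x + e" if "e > 0" for e
    proof -
      have "h\<^sub>1 t x < h\<^sub>2 t x + e / (1 + t) * (1 + t)"
        using t that by (intro strict) auto
      then show ?thesis
        using t by simp
    qed
    then show "h\<^sub>1 t x \<le> h\<^sub>2 t x"
      by (rule field_le_epsilon)
  qed
qed

end
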